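(* Let $\mu\in M_4(\mathbb{R})$ and $S=D\mu D^T\in M_4(\mathbb{R})$. The Pauli diagonal map $\Pi^{(2)}_\mu:\mathcal{M}_4\to\mathcal{M}_4$ is decomposable if and only if for all permutations $\sigma_1,\sigma_2\in S_4$: $S_{\sigma_1(1)\sigma_2(1)}+S_{\sigma_1(1)\sigma_2(2)}+S_{\sigma_1(2)\sigma_2(1)}+S_{\sigma_1(2)\sigma_2(2)}\ge0$, $S_{\sigma_1(1)\sigma_2(1)}+S_{\sigma_1(2)\sigma_2(2)}+S_{\sigma_1(3)\sigma_2(3)}+S_{\sigma_1(4)\sigma_2(4)}\ge0$, $S_{\sigma_1(1)\sigma_2(1)}+S_{\sigma_1(2)\sigma_2(2)}+S_{\sigma_1(3)\sigma_2(3)}+S_{\sigma_1(4)\sigma_2(1)}+S_{\sigma_1(4)\sigma_2(2)}+S_{\sigma_1(4)\sigma_2(3)}\ge0$, $S_{\sigma_1(1)\sigma_2(1)}+S_{\sigma_1(2)\sigma_2(2)}+S_{\sigma_1(3)\sigma_2(3)}+S_{\sigma_1(1)\sigma_2(4)}+S_{\sigma_1(2)\sigma_2(4)}+S_{\sigma_1(3)\sigma_2(4)}\ge0$. Moreover, if $\Pi^{(2)}_\mu$ is positive, then the first two families of inequalities hold automatically.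
   Context: Pauli matrices $\sigma_1=I_2$, $\sigma_2=\begin{pmatrix}0&1\\1&0\end{pmatrix}$, $\sigma_3=\begin{pmatrix}1&0\\0&-1\end{pmatrix}$, $\sigma_4=\begin{pmatrix}0&-i\\i&0\end{pmatrix}$; $\Pi^{(2)}_\mu(X)=\sum_{i,j}\frac{\mu_{ij}}4\mathrm{Tr}[(\sigma_i\otimes\sigma_j)X]\sigma_i\otimes\sigma_j$ on $\mathcal{M}_2\otimes\mathcal{M}_2\cong\mathcal{M}_4$. $D=\frac12\begin{pmatrix}1&1&1&1\\1&1&-1&-1\\1&-1&1&-1\\1&-1&-1&1\end{pmatrix}$; the entries of $S=D\mu D^T$ are the eigenvalues of the Choi matrix of $\Pi^{(2)}_\mu$ ("spectral matrix"). Decomposable means $T+\vartheta\circ S'$ with $T,S'$ completely positive and $\vartheta$ the transpose. *)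

theory Defs
  imports "Jordan_Normal_Form.Matrix" "Jordan_Normal_Form.Conjugate" "HOL-Combinatorics.Permutations"
begin

definition kron :: "complex mat \<Rightarrow> complex mat \<Rightarrow> complex mat" where
  "kron A B = mat (dim_row A * dim_row B) (dim_col A * dim_col B)
     (\<lambda>(i,j). A $$ (i div dim_row B, j div dim_col B) * B $$ (i mod dim_row B, j mod dim_col B))"

definition psd :: "nat \<Rightarrow> complex mat \<Rightarrow> bool" where
  "psd n A \<longleftrightarrow> A \<in> carrier_mat n n \<and>
     (\<forall>v \<in> carrier_vec n. Im (conjugate v \<bullet> (A *\<^sub>v v)) = 0 \<and> 0 \<le> Re (conjugate v \<bullet> (A *\<^sub>v v)))"

text \<open>Linear map from M_n to M_m (only its values on n x n matrices matter).\<close>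
definition lin_map :: "nat \<Rightarrow> nat \<Rightarrow> (complex mat \<Rightarrow> complex mat) \<Rightarrow> bool" where
  "lin_map n m \<Phi> \<longleftrightarrow>
     (\<forall>X \<in> carrier_mat n n. \<Phi> X \<in> carrier_mat m m) \<and>
     (\<forall>X \<in> carrier_mat n n. \<forall>Y \<in> carrier_mat n n. \<Phi> (X + Y) = \<Phi> X + \<Phi> Y) \<and>
     (\<forall>X \<in> carrier_mat n n. \<forall>c. \<Phi> (c \<cdot>\<^sub>m X) = c \<cdot>\<^sub>m \<Phi> X)"

definition positive_map :: "nat \<Rightarrow> nat \<Rightarrow> (complex mat \<Rightarrow> complex mat) \<Rightarrow> bool" where
  "positive_map n m \<Phi> \<longleftrightarrow> (\<forall>X. psd n X \<longrightarrow> psd m (\<Phi> X))"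

definition blk :: "nat \<Rightarrow> complex mat \<Rightarrow> nat \<Rightarrow> nat \<Rightarrow> complex mat" where
  "blk n X a b = mat n n (\<lambda>(p,q). X $$ (a * n + p, b * n + q))"

text \<open>The ampliation id_k \<otimes> \<Phi> : M_k(M_n) \<rightarrow> M_k(M_m), acting blockwise.\<close>
definition ampl :: "nat \<Rightarrow> nat \<Rightarrow> nat \<Rightarrow> (complex mat \<Rightarrow> complex mat) \<Rightarrow> complex mat \<Rightarrow> complex mat" where
  "ampl k n m \<Phi> X = mat (k * m) (k * m) (\<lambda>(i,j). \<Phi> (blk n X (i div m) (j div m)) $$ (i mod m, j mod m))"

definition k_positive :: "nat \<Rightarrow> nat \<Rightarrow> nat \<Rightarrow> (complex mat \<Rightarrow> complex mat) \<Rightarrow> bool" where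
  "k_positive k n m \<Phi> \<longleftrightarrow> (\<forall>X. psd (k * n) X \<longrightarrow> psd (k * m) (ampl k n m \<Phi> X))"

definition completely_positive :: "nat \<Rightarrow> nat \<Rightarrow> (complex mat \<Rightarrow> complex mat) \<Rightarrow> bool" where
  "completely_positive n m \<Phi> \<longleftrightarrow> lin_map n m \<Phi> \<and> (\<forall>k. k_positive k n m \<Phi>)"

definition decomposable :: "nat \<Rightarrow> (complex mat \<Rightarrow> complex mat) \<Rightarrow> bool" where
  "decomposable n \<Phi> \<longleftrightarrow> (\<exists>T S'. completely_positive n n T \<and> completely_positive n n S' \<and>
     (\<forall>X \<in> carrier_mat n n. \<Phi> X = T X + transpose_mat (S' X)))"

definition mtrace :: "complex mat \<Rightarrow> complex" where
  "mtrace A = (\<Sum>i<dim_row A. A $$ (i,i))"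

text \<open>Pauli matrices, 0-indexed: pauli 0 = \<sigma>_1 = I, pauli 1 = \<sigma>_2, pauli 2 = \<sigma>_3, pauli 3 = \<sigma>_4.\<close>
definition pauli :: "nat \<Rightarrow> complex mat" where
  "pauli i = (if i = 0 then mat_of_rows_list 2 [[1, 0], [0, 1]]
     else if i = 1 then mat_of_rows_list 2 [[0, 1], [1, 0]]
     else if i = 2 then mat_of_rows_list 2 [[1, 0], [0, -1]]
     else mat_of_rows_list 2 [[0, -\<i>], [\<i>, 0]])"

definition pauli_diag_map :: "real mat \<Rightarrow> complex mat \<Rightarrow> complex mat" where
  "pauli_diag_map \<mu> X = mat 4 4 (\<lambda>(r,c). \<Sum>i<4. \<Sum>j<4.
      complex_of_real (\<mu> $$ (i,j)) / 4 * mtrace (kron (pauli i) (pauli j) * X)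
      * kron (pauli i) (pauli j) $$ (r,c))"

definition Dmat :: "real mat" where
  "Dmat = (1/2) \<cdot>\<^sub>m mat_of_rows_list 4 [[1,1,1,1],[1,1,-1,-1],[1,-1,1,-1],[1,-1,-1,1]]"

definition spectral_mat :: "real mat \<Rightarrow> real mat" where
  "spectral_mat \<mu> = Dmat * \<mu> * transpose_mat Dmat"

end

theory Submission
  imports Defs
begin

text \<open>Writing \<open>W\<close> for the reflection \<open>refl_coeff\<close>, Fierz identities for the Pauli matrices turn
  \<open>\<Pi>\<^sub>\<mu>\<close> into the Kraus-type sum \<open>1/4 \<Sum> S\<^sub>k\<^sub>l (\<sigma>\<^sub>k \<otimes> \<sigma>\<^sub>l) X (\<sigma>\<^sub>k \<otimes> \<sigma>\<^sub>l)\<close> and composition with the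
  transpose into \<open>S \<mapsto> W S' W\<close> (up to reversing the indices). Hence \<open>\<Pi>\<^sub>\<mu>\<close> is decomposable iff
  \<open>S = P + W Q W\<close> with entrywise nonnegative \<open>P\<close> and \<open>Q\<close>. By Farkas, this holds iff \<open>S\<close> pairs
  nonnegatively with every \<open>M\<close> such that \<open>M \<ge> 0\<close> and \<open>W M W \<ge> 0\<close>. Such an \<open>M\<close> is reduced to zero by
  subtracting multiples of the four families of 0-1 matrices: a nonzero \<open>M\<close> always dominates
  one of them, because \<open>M + W M W\<close> is a multiple of a doubly stochastic matrix and
  \<open>W M W - M\<close> has the form \<open>x\<^sub>i + y\<^sub>j\<close>. Positivity of \<open>\<Pi>\<^sub>\<mu>\<close> gives the first family from product
  vectors, and the second one from maximally entangled vectors twisted by Clifford matrices.\<close>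

section \<open>Cones of linear functionals\<close>

definition linear_fun :: "(('i \<Rightarrow> real) \<Rightarrow> real) \<Rightarrow> bool" where
  "linear_fun f \<longleftrightarrow> (\<forall>x y c. f (\<lambda>i. x i + c * y i) = f x + c * f y)"

lemma linear_funD: "linear_fun f \<Longrightarrow> f (\<lambda>i. x i + c * y i) = f x + c * f y"
  unfolding linear_fun_def by blast

lemma linear_funI:
  "(\<And>x y c. f (\<lambda>i. x i + c * y i) = f x + c * f y) \<Longrightarrow> linear_fun f"
  unfolding linear_fun_def by blast

lemma linear_fun_scale: "linear_fun f \<Longrightarrow> f (\<lambda>i. c * y i) = c * f y"
proof -
  assume f: "linear_fun f"
  have "f (\<lambda>i. 0) = 0"
    using linear_funD[OF f, of "\<lambda>i. 0" 1 "\<lambda>i. 0"] by simp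
  then show ?thesis
    using linear_funD[OF f, of "\<lambda>i. 0" c y] by simp
qed

text \<open>Bartl's proof of the Farkas lemma. If dropping the functional \<open>a k\<close> breaks the hypothesis at a
  point \<open>z\<close>, all functionals are projected along \<open>z\<close> onto the kernel of \<open>a k\<close>.\<close>
lemma farkas:
  fixes a :: "'k \<Rightarrow> ('i \<Rightarrow> real) \<Rightarrow> real"
  assumes "finite K" "\<And>k. k \<in> K \<Longrightarrow> linear_fun (a k)" "linear_fun b"
    and "\<And>x. (\<And>k. k \<in> K \<Longrightarrow> 0 \<le> a k x) \<Longrightarrow> 0 \<le> b x"
  shows "\<exists>w. (\<forall>k\<in>K. 0 \<le> w k) \<and> (\<forall>x. b x = (\<Sum>k\<in>K. w k * a k x))"
  using assms
proof (induction K arbitrary: a b rule: finite_induct)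
  case empty
  have "b x = 0" for x
  proof -
    have "0 \<le> b x" "0 \<le> b (\<lambda>i. (-1) * x i)"
      by (rule empty.prems(3); simp)+
    then show ?thesis
      unfolding linear_fun_scale[OF empty.prems(2)] by linarith
  qed
  then show ?case by simp
next
  case (insert k K)
  have lin: "linear_fun (a j)" if "j \<in> insert k K" for j
    using insert.prems(1) that by blast
  show ?case
  proof (cases "\<forall>x. (\<forall>j\<in>K. 0 \<le> a j x) \<longrightarrow> 0 \<le> b x")
    case True
    then obtain w where w: "\<forall>j\<in>K. 0 \<le> w j" "\<forall>x. b x = (\<Sum>j\<in>K. w j * a j x)"
      using insert.IH[of a b] lin insert.prems(2) by blast
    have "(\<Sum>j\<in>K. (w(k := 0)) j * a j x) = (\<Sum>j\<in>K. w j * a j x)" for x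
      using insert.hyps by (intro sum.cong) auto
    then show ?thesis
      using w insert.hyps by (intro exI[of _ "w(k := 0)"]) auto
  next
    case False
    then obtain z where z: "\<forall>j\<in>K. 0 \<le> a j z" "b z < 0" by force
    have "a k z < 0"
      using insert.prems(3)[of z] z by fastforce
    \<comment> \<open>A positive multiple of \<open>z\<close>, since \<open>a k z < 0\<close>,
      scaled so that \<open>a k u = -1\<close>. Then \<open>x + a k x * u\<close> lies in the kernel
      of \<open>a k\<close> for every \<open>x\<close>.\<close>
    define u where "u = (\<lambda>i. (- 1 / a k z) * z i)"
    have au: "a j u = (- 1 / a k z) * a j z" if "j \<in> insert k K" for j
      unfolding u_def using linear_fun_scale[OF lin[OF that]] .
    have bu: "b u = (- 1 / a k z) * b z"
      unfolding u_def using linear_fun_scale[OF insert.prems(2)] .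
    have aku: "a k u = -1"
      using au[of k] \<open>a k z < 0\<close> by simp
    have aju: "0 \<le> a j u" if "j \<in> K" for j
      using au[of j] that z(1) \<open>a k z < 0\<close> by (simp add: divide_nonneg_neg zero_le_divide_iff)
    have "b u < 0"
      unfolding bu using z(2) \<open>a k z < 0\<close> by (simp add: divide_neg_neg)
    define proj where "proj = (\<lambda>f x. f x + a k x * f u :: real)"
    have proj: "proj f x = f (\<lambda>i. x i + a k x * u i)" if "linear_fun f" for f x
      by (simp only: proj_def linear_funD[OF that, of x "a k x" u])
    have proj_lin: "linear_fun (proj f)" if "linear_fun f" for f
    proof (rule linear_funI)
      fix x y :: "'i \<Rightarrow> real" and c :: real
      have "a k (\<lambda>i. x i + c * y i) = a k x + c * a k y" "f (\<lambda>i. x i + c * y i) = f x + c * f y"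
        using linear_funD lin[of k] that by blast+
      then show "proj f (\<lambda>i. x i + c * y i) = proj f x + c * proj f y"
        by (simp only: proj_def) (simp add: algebra_simps)
    qed
    have "\<exists>w. (\<forall>j\<in>K. 0 \<le> w j) \<and> (\<forall>x. proj b x = (\<Sum>j\<in>K. w j * proj (a j) x))"
    proof (rule insert.IH)
      show "linear_fun (proj (a j))" if "j \<in> K" for j
        using lin that by (intro proj_lin) auto
      show "linear_fun (proj b)"
        using insert.prems(2) by (rule proj_lin)
      fix x
      assume x: "\<And>j. j \<in> K \<Longrightarrow> 0 \<le> proj (a j) x"
      show "0 \<le> proj b x"
        unfolding proj[OF insert.prems(2)]
      proof (rule insert.prems(3))
        fix j assume j: "j \<in> insert k K"
        show "0 \<le> a j (\<lambda>i. x i + a k x * u i)"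
        proof (cases "j = k")
          case True
          then show ?thesis using linear_funD[OF lin[of k], of x "a k x" u] aku by simp
        next
          case False
          then show ?thesis using x[of j] j proj[OF lin[OF j], of x] by simp
        qed
      qed
    qed
    then obtain w where w: "\<forall>j\<in>K. 0 \<le> w j" "\<forall>x. proj b x = (\<Sum>j\<in>K. w j * proj (a j) x)"
      by blast
    \<comment> \<open>The coefficient of \<open>a k x\<close> once the identity for the projected
      functionals is expanded and \<open>a k x * b u\<close> is moved to the right. It is
      nonnegative because \<open>b u < 0\<close>.\<close>
    define c where "c = (\<Sum>j\<in>K. w j * a j u) - b u"
    have "0 \<le> (\<Sum>j\<in>K. w j * a j u)"
      using w(1) aju by (intro sum_nonneg) auto
    then have "0 \<le> c"
      using \<open>b u < 0\<close> by (simp add: c_def)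
    have "b x = (\<Sum>j\<in>K. w j * a j x) + c * a k x" for x
    proof -
      have "b x + a k x * b u = (\<Sum>j\<in>K. w j * a j x) + a k x * (\<Sum>j\<in>K. w j * a j u)"
        using w(2) unfolding proj_def by (simp add: algebra_simps sum.distrib sum_distrib_left)
      then show ?thesis by (simp add: c_def algebra_simps)
    qed
    moreover have "(\<Sum>j\<in>K. (w(k := c)) j * a j x) = (\<Sum>j\<in>K. w j * a j x)" for x
      using insert.hyps by (intro sum.cong) auto
    ultimately show ?thesis
      using w(1) \<open>0 \<le> c\<close> insert.hyps by (intro exI[of _ "w(k := c)"]) auto
  qed
qed

text \<open>A point \<open>x\<close> of the cone is reduced by the largest multiple of some
  \<open>g\<close> in \<open>G\<close> that stays in the cone. Because every functional vanishing at
  \<open>x\<close> vanishes at \<open>g\<close>, none becomes nonzero again and at least one more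
  becomes zero. The induction on the number of nonzero values ends at a point covered by
  \<open>pointed\<close>.\<close>

lemma nonneg_on_cone:
  fixes a :: "'k \<Rightarrow> ('i \<Rightarrow> real) \<Rightarrow> real"
  assumes "finite K" and lin: "\<And>k. k \<in> K \<Longrightarrow> linear_fun (a k)" and "linear_fun b"
    and pointed: "\<And>x. (\<And>k. k \<in> K \<Longrightarrow> a k x = 0) \<Longrightarrow> 0 \<le> b x"
    and G: "\<And>g. g \<in> G \<Longrightarrow> 0 \<le> b g"
    and gen: "\<And>x k. (\<And>k. k \<in> K \<Longrightarrow> 0 \<le> a k x) \<Longrightarrow> k \<in> K \<Longrightarrow> a k x \<noteq> 0 \<Longrightarrow>
      \<exists>g\<in>G. (\<forall>k\<in>K. 0 \<le> a k g) \<and> (\<exists>k\<in>K. a k g \<noteq> 0) \<and> (\<forall>k\<in>K. a k x = 0 \<longrightarrow> a k g = 0)"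
    and "\<And>k. k \<in> K \<Longrightarrow> 0 \<le> a k x"
  shows "0 \<le> b x"
  using assms(7)
proof (induction "card {k\<in>K. a k x \<noteq> 0}" arbitrary: x rule: less_induct)
  case less
  show ?case
  proof (cases "\<forall>k\<in>K. a k x = 0")
    case True
    then show ?thesis using pointed by blast
  next
    case False
    then obtain g where g: "g \<in> G" "\<forall>k\<in>K. 0 \<le> a k g" "\<exists>k\<in>K. a k g \<noteq> 0"
      "\<forall>k\<in>K. a k x = 0 \<longrightarrow> a k g = 0"
      using gen[of x] less.prems by blast
    define L where "L = {k\<in>K. a k g \<noteq> 0}"
    have L: "finite L" "L \<noteq> {}" using g(3) \<open>finite K\<close> by (auto simp: L_def)
    \<comment> \<open>The largest \<open>t\<close> for which \<open>x - t g\<close> stays in the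
      cone. The minimum is attained at some \<open>l\<close>, whose functional vanishes after the
      subtraction.\<close>
    define t where "t = Min ((\<lambda>k. a k x / a k g) ` L)"
    have "t \<in> (\<lambda>k. a k x / a k g) ` L"
      unfolding t_def using L by (intro Min_in) auto
    then obtain l where l: "l \<in> L" "t = a l x / a l g" by blast
    have "0 \<le> t"
      using l g(2) less.prems by (auto simp: L_def)
    define y where "y = (\<lambda>i. x i + (- t) * g i)"
    have ay: "a k y = a k x - t * a k g" if "k \<in> K" for k
      unfolding y_def using linear_funD[OF lin[OF that], of x "- t" g] by simp
    have "0 \<le> a k y" if k: "k \<in> K" for k
    proof (cases "k \<in> L")
      case True
      then have "t \<le> a k x / a k g"
        unfolding t_def using L by (intro Min_le) auto
      moreover have "0 < a k g" using True g(2) by (force simp: L_def)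
      ultimately show ?thesis using ay[OF k] by (simp add: field_simps)
    next
      case False
      then show ?thesis using ay[OF k] less.prems k by (simp add: L_def)
    qed
    moreover have "card {k\<in>K. a k y \<noteq> 0} < card {k\<in>K. a k x \<noteq> 0}"
    proof (rule psubset_card_mono)
      have "a l y = 0" "a l x \<noteq> 0" "l \<in> K"
        using l ay[of l] g(4) by (auto simp: L_def)
      moreover have "a k y = 0" if "k \<in> K" "a k x = 0" for k
        using that ay g(4) by simp
      ultimately show "{k\<in>K. a k y \<noteq> 0} \<subset> {k\<in>K. a k x \<noteq> 0}" by blast
    qed (use \<open>finite K\<close> in simp)
    ultimately have "0 \<le> b y" using less.hyps by blast
    moreover have "b y = b x - t * b g"
      unfolding y_def using linear_funD[OF \<open>linear_fun b\<close>, of x "- t" g] by simp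
    ultimately show ?thesis using G[OF g(1)] \<open>0 \<le> t\<close>
      by (smt (verit) mult_nonneg_nonneg)
  qed
qed

section \<open>The dual cone of the reflection pair\<close>

lemma lessThan_4: "{..<4::nat} = {0,1,2,3}" by auto

lemma sum_lessThan_4: "(\<Sum>i<4. f i) = f 0 + f 1 + f 2 + f (3::nat)"
  by (simp add: lessThan_4 add.assoc)

lemma less_4_disj: "i < 4 \<Longrightarrow> i = 0 \<or> i = 1 \<or> i = 2 \<or> i = (3::nat)"
  by linarith

lemma ex_less_4: "(\<exists>i<4. P i) \<longleftrightarrow> P 0 \<or> P 1 \<or> P 2 \<or> P (3::nat)"
proof -
  have "(\<exists>i<4. P i) \<longleftrightarrow> (\<exists>i\<in>{..<4}. P i)" by blast
  then show ?thesis by (simp add: lessThan_4)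
qed

lemma permutes_tuple:
  assumes "distinct [a,b,c,d]" "{a,b,c,d} \<subseteq> {..<4::nat}"
  obtains p where "p permutes {..<4}" "p 0 = a" "p 1 = b" "p 2 = c" "p 3 = d"
proof
  define p where "p = (\<lambda>i::nat. if i = 0 then a else if i = 1 then b else if i = 2 then c
    else if i = 3 then d else i)"
  show "p 0 = a" "p 1 = b" "p 2 = c" "p 3 = d" by (simp_all add: p_def)
  have "inj_on p {..<4}" using assms(1) by (auto simp: lessThan_4 p_def)
  moreover have "p ` {..<4} \<subseteq> {..<4}" using assms(2) by (auto simp: lessThan_4 p_def)
  ultimately have "bij_betw p {..<4} {..<4}"
    by (simp add: bij_betw_def endo_inj_surj)
  then show "p permutes {..<4}"
    by (rule bij_imp_permutes) (simp add: p_def)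
qed

lemma sorting_permutation:
  fixes x :: "nat \<Rightarrow> real"
  obtains p where "p permutes {..<4}" "x (p 0) \<ge> x (p 1)" "x (p 1) \<ge> x (p 2)" "x (p 2) \<ge> x (p 3)"
proof -
  define l where "l = sort_key (\<lambda>i. - x i) [0,1,2,3::nat]"
  have "length l = 4" "distinct l" "set l = {..<4}" "sorted (map (\<lambda>i. - x i) l)"
    by (auto simp: l_def lessThan_4)
  moreover from this(1) obtain a b c d where "l = [a,b,c,d]"
    by (auto simp: numeral_eq_Suc length_Suc_conv)
  ultimately have "distinct [a,b,c,d]" "{a,b,c,d} \<subseteq> {..<4}" and x: "x a \<ge> x b" "x b \<ge> x c" "x c \<ge> x d"
    by auto
  from this(1,2) obtain p where "p permutes {..<4}" "p 0 = a" "p 1 = b" "p 2 = c" "p 3 = d"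
    by (rule permutes_tuple)
  with x that[of p] show ?thesis by simp
qed

text \<open>With \<open>J\<close> the all-ones matrix this is \<open>J/2 - I\<close>, the orthogonal
  reflection fixing the all-ones vector and negating its complement. It is symmetric and its own
  inverse.\<close>

definition refl_coeff :: "nat \<Rightarrow> nat \<Rightarrow> real" where
  "refl_coeff i j = (if i = j then - 1/2 else 1/2)"

text \<open>Pairs of 0-1 matrices exchanged by conjugation with \<open>refl_coeff\<close>: up to row and column
  permutations, these are the extreme rays of the dual cone.\<close>
definition ray_patterns :: "((nat \<Rightarrow> nat \<Rightarrow> bool) \<times> (nat \<Rightarrow> nat \<Rightarrow> bool)) set" where
  "ray_patterns =
    {(\<lambda>i j. i < 2 \<and> j < 2, \<lambda>i j. 2 \<le> i \<and> 2 \<le> j),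
     (\<lambda>i j. i = j, \<lambda>i j. i = j),
     (\<lambda>i j. j < 3 \<and> (i = j \<or> i = 3), \<lambda>i j. i < 3 \<and> (i = j \<or> j = 3)),
     (\<lambda>i j. i < 3 \<and> (i = j \<or> j = 3), \<lambda>i j. j < 3 \<and> (i = j \<or> i = 3))}"

definition refl_conj :: "(nat \<times> nat \<Rightarrow> real) \<Rightarrow> nat \<Rightarrow> nat \<Rightarrow> real" where
  "refl_conj M a b = (\<Sum>i<4. \<Sum>j<4. refl_coeff a i * refl_coeff b j * M (i,j))"

lemma refl_conj_pattern:
  assumes "(c,d) \<in> ray_patterns" "a < 4" "b < 4"
  shows "refl_conj (\<lambda>(i,j). of_bool (c i j)) a b = of_bool (d a b)"
proof -
  have "(c,d) \<in> ray_patterns \<Longrightarrow> ?thesis"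
    unfolding ray_patterns_def refl_conj_def sum_lessThan_4 refl_coeff_def
    using less_4_disj[OF assms(2)] less_4_disj[OF assms(3)]
    by (elim disjE insertE emptyE Pair_inject; hypsubst) simp_all
  then show ?thesis using assms(1) by blast
qed

text \<open>The sorting hypotheses only shrink the case analysis of the final SMT step.\<close>
lemma support_contains_pattern_sorted:
  fixes M N :: "nat \<Rightarrow> nat \<Rightarrow> real"
  assumes nonneg: "\<And>i j. i < 4 \<Longrightarrow> j < 4 \<Longrightarrow> 0 \<le> M i j \<and> 0 \<le> N i j"
    and diff: "\<And>i j. i < 4 \<Longrightarrow> j < 4 \<Longrightarrow> N i j - M i j = x i + y j"
    and sorted: "x 0 \<ge> x 1" "x 1 \<ge> x 2" "x 2 \<ge> x 3" "y 0 \<ge> y 1" "y 1 \<ge> y 2" "y 2 \<ge> y 3"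
    and zero: "x 0 + x 1 + x 2 + x 3 = 0" "y 0 + y 1 + y 2 + y 3 = 0"
    and row: "\<And>i. i < 4 \<Longrightarrow> (\<Sum>j<4. M i j + N i j) = r"
    and col: "\<And>j. j < 4 \<Longrightarrow> (\<Sum>i<4. M i j + N i j) = r"
    and "0 < r"
  shows "\<exists>(c,d)\<in>ray_patterns. \<exists>p q. p permutes {..<4} \<and> q permutes {..<4} \<and>
    (\<forall>i<4. \<forall>j<4. (c i j \<longrightarrow> M (p i) (q j) \<noteq> 0) \<and> (d i j \<longrightarrow> N (p i) (q j) \<noteq> 0))"
proof (rule ccontr)
  assume *: "\<not> ?thesis"
  have zeros: "\<exists>i<4. \<exists>j<4. c i j \<and> M (p i) (q j) = 0 \<or> d i j \<and> N (p i) (q j) = 0"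
    if "(c,d) \<in> ray_patterns" "p permutes {..<4}" "q permutes {..<4}" for c d p q
    using * that by blast
  \<comment> \<open>The failure of each of the four patterns, with the row permutation spelled out
    as \<open>a,b,c,d\<close> and the column permutation as \<open>a',b',c',d'\<close>.\<close>
  have zeros_tuple:
    "M a a' = 0 \<or> M a b' = 0 \<or> M b a' = 0 \<or> M b b' = 0 \<or>
     N c c' = 0 \<or> N c d' = 0 \<or> N d c' = 0 \<or> N d d' = 0" (is ?block)
    "M a a' = 0 \<or> M b b' = 0 \<or> M c c' = 0 \<or> M d d' = 0 \<or>
     N a a' = 0 \<or> N b b' = 0 \<or> N c c' = 0 \<or> N d d' = 0" (is ?diag)
    "M a a' = 0 \<or> M b b' = 0 \<or> M c c' = 0 \<or> M d a' = 0 \<or> M d b' = 0 \<or> M d c' = 0 \<or>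
     N a a' = 0 \<or> N b b' = 0 \<or> N c c' = 0 \<or> N a d' = 0 \<or> N b d' = 0 \<or> N c d' = 0" (is ?row)
    "M a a' = 0 \<or> M b b' = 0 \<or> M c c' = 0 \<or> M a d' = 0 \<or> M b d' = 0 \<or> M c d' = 0 \<or>
     N a a' = 0 \<or> N b b' = 0 \<or> N c c' = 0 \<or> N d a' = 0 \<or> N d b' = 0 \<or> N d c' = 0" (is ?col)
    if t: "distinct [a,b,c,d] \<and> {a,b,c,d} \<subseteq> {..<4}" "distinct [a',b',c',d'] \<and> {a',b',c',d'} \<subseteq> {..<4}"
    for a b c d a' b' c' d'
  proof -
    obtain p where p: "p permutes {..<4}" "p 0 = a" "p 1 = b" "p 2 = c" "p 3 = d"
      by (rule permutes_tuple[OF conjunct1[OF t(1)] conjunct2[OF t(1)]])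
    obtain q where q: "q permutes {..<4}" "q 0 = a'" "q 1 = b'" "q 2 = c'" "q 3 = d'"
      by (rule permutes_tuple[OF conjunct1[OF t(2)] conjunct2[OF t(2)]])
    note z = zeros[OF _ p(1) q(1), unfolded ray_patterns_def ex_less_4 p(2-) q(2-)]
    show ?block using z[of "\<lambda>i j. i < 2 \<and> j < 2" "\<lambda>i j. 2 \<le> i \<and> 2 \<le> j"] by simp
    show ?diag using z[of "\<lambda>i j. i = j" "\<lambda>i j. i = j"] by auto
    show ?row using z[of "\<lambda>i j. j < 3 \<and> (i = j \<or> i = 3)" "\<lambda>i j. i < 3 \<and> (i = j \<or> j = 3)"] by auto
    show ?col using z[of "\<lambda>i j. i < 3 \<and> (i = j \<or> j = 3)" "\<lambda>i j. j < 3 \<and> (i = j \<or> i = 3)"] by auto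
  qed
  \<comment> \<open>The 32 entries and 8 offsets become separate real unknowns, which leaves a
    problem of linear real arithmetic with disjunctions. \<open>Suc 0\<close> is the form in which
    the simplifier leaves the index 1.\<close>
  define m00 m01 m02 m03 m10 m11 m12 m13 m20 m21 m22 m23 m30 m31 m32 m33 n00 n01 n02 n03 n10 n11 n12
    n13 n20 n21 n22 n23 n30 n31 n32 n33 x0 x1 x2 x3 y0 y1 y2 y3
    where vars: "m00 = M 0 0" and "m01 = M 0 (Suc 0)" and "m02 = M 0 2" and "m03 = M 0 3" and
      "m10 = M (Suc 0) 0" and "m11 = M (Suc 0) (Suc 0)" and "m12 = M (Suc 0) 2" and
      "m13 = M (Suc 0) 3" and "m20 = M 2 0" and "m21 = M 2 (Suc 0)" and "m22 = M 2 2" and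
      "m23 = M 2 3" and "m30 = M 3 0" and "m31 = M 3 (Suc 0)" and "m32 = M 3 2" and
      "m33 = M 3 3" and "n00 = N 0 0" and "n01 = N 0 (Suc 0)" and "n02 = N 0 2" and
      "n03 = N 0 3" and "n10 = N (Suc 0) 0" and "n11 = N (Suc 0) (Suc 0)" and
      "n12 = N (Suc 0) 2" and "n13 = N (Suc 0) 3" and "n20 = N 2 0" and "n21 = N 2 (Suc 0)" and
      "n22 = N 2 2" and "n23 = N 2 3" and "n30 = N 3 0" and "n31 = N 3 (Suc 0)" and
      "n32 = N 3 2" and "n33 = N 3 3" and "x0 = x 0" and "x1 = x (Suc 0)" and "x2 = x 2" and
      "x3 = x 3" and "y0 = y 0" and "y1 = y (Suc 0)" and "y2 = y 2" and "y3 = y 3"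
  note vars = vars[symmetric]
  \<comment> \<open>One representative per set of placements that mark the same entries. A block
    depends only on which two rows and which two columns come first. In the last two patterns only
    the distinguished row \<open>d\<close> is chosen, because reordering \<open>a,b,c\<close> is
    absorbed by running over all column orders.\<close>
  let ?pairs = "{(0,1,2,3), (0,2,1,3), (0,3,1,2), (1,2,0,3), (1,3,0,2), (2,3,0,1::nat)}"
  let ?triples = "{(0,1,2,3), (0,1,3,2), (0,2,3,1), (1,2,3,0::nat)}"
  let ?perms = "\<lambda>P. \<forall>a\<in>{..<4}. \<forall>b\<in>{..<4}. \<forall>c\<in>{..<4}. \<forall>d\<in>{..<4::nat}.
    distinct [a,b,c,d] \<longrightarrow> P a b c d"
  have tuples: "distinct [a,b,c,d] \<and> {a,b,c,d} \<subseteq> {..<4}"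
    if "(a,b,c,d) \<in> ?pairs \<union> ?triples" for a b c d
    using that by (auto simp: lessThan_4)
  have "\<forall>(a,b,c,d)\<in>?pairs. \<forall>(a',b',c',d')\<in>?pairs.
    M a a' = 0 \<or> M a b' = 0 \<or> M b a' = 0 \<or> M b b' = 0 \<or>
    N c c' = 0 \<or> N c d' = 0 \<or> N d c' = 0 \<or> N d d' = 0"
    unfolding Ball_def split_paired_All prod.case
  proof (intro allI impI)
    fix a b c d a' b' c' d' :: nat
    assume "(a,b,c,d) \<in> ?pairs" "(a',b',c',d') \<in> ?pairs"
    then show "M a a' = 0 \<or> M a b' = 0 \<or> M b a' = 0 \<or> M b b' = 0 \<or>
    N c c' = 0 \<or> N c d' = 0 \<or> N d c' = 0 \<or> N d d' = 0"
      by (intro zeros_tuple(1) tuples UnI1)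
  qed
  note blocks = this[simplified, unfolded vars]
  \<comment> \<open>Permuting rows and columns simultaneously does not change which entries a
    diagonal marks, so the rows keep their order and the 24 column orders suffice.\<close>
  have "?perms (\<lambda>a' b' c' d'.
    M 0 a' = 0 \<or> M 1 b' = 0 \<or> M 2 c' = 0 \<or> M 3 d' = 0 \<or>
    N 0 a' = 0 \<or> N 1 b' = 0 \<or> N 2 c' = 0 \<or> N 3 d' = 0)"
    by (intro ballI impI zeros_tuple(2)) (simp_all add: lessThan_4)
  note diagonals = this[unfolded lessThan_4, simplified, unfolded vars]
  have "\<forall>(a,b,c,d)\<in>?triples. ?perms (\<lambda>a' b' c' d'.
    M a a' = 0 \<or> M b b' = 0 \<or> M c c' = 0 \<or> M d a' = 0 \<or> M d b' = 0 \<or> M d c' = 0 \<or>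
    N a a' = 0 \<or> N b b' = 0 \<or> N c c' = 0 \<or> N a d' = 0 \<or> N b d' = 0 \<or> N c d' = 0)"
    unfolding Ball_def split_paired_All prod.case
  proof (intro allI impI)
    fix a b c d a' b' c' d' :: nat
    assume "(a,b,c,d) \<in> ?triples" "a' \<in> {..<4}" "b' \<in> {..<4}" "c' \<in> {..<4}" "d' \<in> {..<4}" "distinct [a',b',c',d']"
    then show "M a a' = 0 \<or> M b b' = 0 \<or> M c c' = 0 \<or> M d a' = 0 \<or> M d b' = 0 \<or> M d c' = 0 \<or>
    N a a' = 0 \<or> N b b' = 0 \<or> N c c' = 0 \<or> N a d' = 0 \<or> N b d' = 0 \<or> N c d' = 0"
      by (intro zeros_tuple(3)[OF tuples[OF UnI2]]) simp_all
  qed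
  note rows = this[unfolded lessThan_4, simplified, unfolded vars]
  have "\<forall>(a,b,c,d)\<in>?triples. ?perms (\<lambda>a' b' c' d'.
    M a a' = 0 \<or> M b b' = 0 \<or> M c c' = 0 \<or> M a d' = 0 \<or> M b d' = 0 \<or> M c d' = 0 \<or>
    N a a' = 0 \<or> N b b' = 0 \<or> N c c' = 0 \<or> N d a' = 0 \<or> N d b' = 0 \<or> N d c' = 0)"
    unfolding Ball_def split_paired_All prod.case
  proof (intro allI impI)
    fix a b c d a' b' c' d' :: nat
    assume "(a,b,c,d) \<in> ?triples" "a' \<in> {..<4}" "b' \<in> {..<4}" "c' \<in> {..<4}" "d' \<in> {..<4}" "distinct [a',b',c',d']"
    then show "M a a' = 0 \<or> M b b' = 0 \<or> M c c' = 0 \<or> M a d' = 0 \<or> M b d' = 0 \<or> M c d' = 0 \<or>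
    N a a' = 0 \<or> N b b' = 0 \<or> N c c' = 0 \<or> N d a' = 0 \<or> N d b' = 0 \<or> N d c' = 0"
      by (intro zeros_tuple(4)[OF tuples[OF UnI2]]) simp_all
  qed
  note cols = this[unfolded lessThan_4, simplified, unfolded vars]
  have "\<forall>i\<in>{..<4}. \<forall>j\<in>{..<4}. 0 \<le> M i j \<and> 0 \<le> N i j \<and> N i j - M i j = x i + y j"
    using nonneg diff by simp
  note entries = this[unfolded lessThan_4, simplified, unfolded vars]
  have "\<forall>i\<in>{..<4}. (\<Sum>j<4. M i j + N i j) = r" "\<forall>j\<in>{..<4}. (\<Sum>i<4. M i j + N i j) = r"
    using row col by simp_all
  note sums = this[unfolded sum_lessThan_4, unfolded lessThan_4, simplified, unfolded vars]
  note order = sorted[simplified, unfolded vars] zero[simplified, unfolded vars]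
  \<comment> \<open>The 36 blocks, 24 diagonals and twice 96 placements of the last two patterns
    each force a zero of \<open>M\<close> or \<open>N\<close>. No nonnegative pair with difference
    \<open>x i + y j\<close> and equal positive line sums satisfies all of these.\<close>
  show False
    using blocks diagonals rows cols entries sums order \<open>0 < r\<close> using [[smt_timeout=600]]
    by (smt (z3))
qed

text \<open>Reduction to the sorted case: rows are ordered by their offset \<open>x\<close>, columns
  by \<open>y\<close>, and the permutations found there are composed with the sorting ones.\<close>

lemma support_contains_pattern:
  assumes nonneg: "\<And>i j. i < 4 \<Longrightarrow> j < 4 \<Longrightarrow> 0 \<le> M (i,j) \<and> 0 \<le> refl_conj M i j"
    and nonzero: "\<exists>i<4. \<exists>j<4. M (i,j) \<noteq> 0"
  shows "\<exists>(c,d)\<in>ray_patterns. \<exists>p q. p permutes {..<4} \<and> q permutes {..<4} \<and>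
    (\<forall>i<4. \<forall>j<4. (c i j \<longrightarrow> M (p i, q j) \<noteq> 0) \<and> (d i j \<longrightarrow> refl_conj M (p i) (q j) \<noteq> 0))"
proof -
  define N where "N = refl_conj M"
  define T where "T = (\<Sum>i<4. \<Sum>j<4. M (i,j))"
  \<comment> \<open>Expanding \<open>(J/2 - I) M (J/2 - I)\<close> adds to each entry of
    \<open>M\<close> a quarter of the total and subtracts half of its row sum and half of its column
    sum. The quarter is split evenly between \<open>x\<close> and \<open>y\<close>, so each family
    of offsets sums to zero.\<close>
  define x where "x i = T/8 - (\<Sum>j<4. M (i,j)) / 2" for i
  define y where "y j = T/8 - (\<Sum>i<4. M (i,j)) / 2" for j
  obtain p where p: "p permutes {..<4}" "x (p 0) \<ge> x (p 1)" "x (p 1) \<ge> x (p 2)" "x (p 2) \<ge> x (p 3)"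
    by (rule sorting_permutation)
  obtain q where q: "q permutes {..<4}" "y (q 0) \<ge> y (q 1)" "y (q 1) \<ge> y (q 2)" "y (q 2) \<ge> y (q 3)"
    by (rule sorting_permutation)
  have N: "N i j - M (i,j) = x i + y j" if "i < 4" "j < 4" for i j
    using less_4_disj[OF that(1)] less_4_disj[OF that(2)]
    unfolding N_def refl_conj_def x_def y_def T_def sum_lessThan_4 refl_coeff_def
    by (elim disjE) (simp_all add: field_simps)
  \<comment> \<open>Four copies of \<open>x i\<close> cancel twice the row sum of \<open>M\<close>
    and leave \<open>T/2\<close>, while the \<open>y j\<close> sum to zero.\<close>
  have row: "(\<Sum>j<4. M (i,j) + N i j) = T/2" if "i < 4" for i
  proof -
    have "(\<Sum>j<4. M (i,j) + N i j) = (\<Sum>j<4. 2 * M (i,j) + (x i + y j))"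
      by (intro sum.cong refl) (use N[OF that] in \<open>force simp: algebra_simps\<close>)
    also have "\<dots> = T/2"
      using less_4_disj[OF that] unfolding lessThan_4 x_def y_def T_def by (elim disjE) (simp_all add: field_simps)
    finally show ?thesis .
  qed
  have col: "(\<Sum>i<4. M (i,j) + N i j) = T/2" if "j < 4" for j
  proof -
    have "(\<Sum>i<4. M (i,j) + N i j) = (\<Sum>i<4. 2 * M (i,j) + (x i + y j))"
      by (intro sum.cong refl) (use N[OF _ that] in \<open>force simp: algebra_simps\<close>)
    also have "\<dots> = T/2"
      using less_4_disj[OF that] unfolding lessThan_4 x_def y_def T_def by (elim disjE) (simp_all add: field_simps)
    finally show ?thesis .
  qed
  have "0 < T"
  proof -
    obtain i j where ij: "i < 4" "j < 4" "M (i,j) \<noteq> 0" using nonzero by blast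
    have "0 < M (i,j)" using ij nonneg by force
    also have "\<dots> \<le> (\<Sum>j<4. M (i,j))" using ij nonneg by (intro member_le_sum) auto
    also have "\<dots> \<le> T" unfolding T_def
      using ij nonneg by (intro member_le_sum[of i _ "\<lambda>i. \<Sum>j<4. M (i,j)"] sum_nonneg) auto
    finally show ?thesis .
  qed
  have pq4: "p i < 4" "q i < 4" if "i < 4" for i
    using that permutes_in_image[OF p(1), of i] permutes_in_image[OF q(1), of i] by auto
  have sum_p: "(\<Sum>i<4. f (p i)) = (\<Sum>i<4. f i)" for f :: "nat \<Rightarrow> real"
    using sum.permute[OF p(1), of f] by (simp add: comp_def)
  have sum_q: "(\<Sum>i<4. f (q i)) = (\<Sum>i<4. f i)" for f :: "nat \<Rightarrow> real"
    using sum.permute[OF q(1), of f] by (simp add: comp_def)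
  have "\<exists>(c,d)\<in>ray_patterns. \<exists>p' q'. p' permutes {..<4} \<and> q' permutes {..<4} \<and>
    (\<forall>i<4. \<forall>j<4. (c i j \<longrightarrow> M (p (p' i), q (q' j)) \<noteq> 0) \<and> (d i j \<longrightarrow> N (p (p' i)) (q (q' j)) \<noteq> 0))"
  proof (rule support_contains_pattern_sorted[of "\<lambda>i j. M (p i, q j)" "\<lambda>i j. N (p i) (q j)"
        "\<lambda>i. x (p i)" "\<lambda>j. y (q j)" "T/2"])
    have "(\<Sum>i<4. x i) = 0" "(\<Sum>i<4. y i) = 0"
      unfolding x_def y_def T_def sum_lessThan_4 by (simp_all add: field_simps)
    then show "x (p 0) + x (p 1) + x (p 2) + x (p 3) = 0" "y (q 0) + y (q 1) + y (q 2) + y (q 3) = 0"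
      using sum_p[of x] sum_q[of y] by (simp_all add: sum_lessThan_4)
    show "(\<Sum>j<4. M (p i, q j) + N (p i) (q j)) = T/2" if "i < 4" for i
      using row[of "p i"] pq4 that sum_q[of "\<lambda>j. M (p i, j) + N (p i) j"] by simp
    show "(\<Sum>i<4. M (p i, q j) + N (p i) (q j)) = T/2" if "j < 4" for j
      using col[of "q j"] pq4 that sum_p[of "\<lambda>i. M (i, q j) + N i (q j)"] by simp
  qed (use p q pq4 N nonneg \<open>0 < T\<close> in \<open>auto simp: N_def\<close>)
  then obtain c d p' q' where cd: "(c,d)\<in>ray_patterns" and pq': "p' permutes {..<4}" "q' permutes {..<4}"
    and "\<forall>i<4. \<forall>j<4. (c i j \<longrightarrow> M (p (p' i), q (q' j)) \<noteq> 0) \<and> (d i j \<longrightarrow> N (p (p' i)) (q (q' j)) \<noteq> 0)"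
    by blast
  then have "(p \<circ> p') permutes {..<4} \<and> (q \<circ> q') permutes {..<4} \<and>
    (\<forall>i<4. \<forall>j<4. (c i j \<longrightarrow> M ((p \<circ> p') i, (q \<circ> q') j) \<noteq> 0) \<and>
      (d i j \<longrightarrow> refl_conj M ((p \<circ> p') i) ((q \<circ> q') j) \<noteq> 0))"
    using permutes_compose p(1) q(1) by (auto simp: N_def)
  then show ?thesis using cd by blast
qed

section \<open>Permuted patterns and the decomposition by duality\<close>

definition ray :: "(nat \<Rightarrow> nat \<Rightarrow> bool) \<Rightarrow> (nat \<Rightarrow> nat) \<Rightarrow> (nat \<Rightarrow> nat) \<Rightarrow> nat \<times> nat \<Rightarrow> real" where
  "ray c p q = (\<lambda>(i,j). of_bool (c (inv_into UNIV p i) (inv_into UNIV q j)))"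

lemma sum_permuted:
  fixes f :: "nat \<Rightarrow> nat \<Rightarrow> real"
  assumes "p permutes {..<n}" "q permutes {..<n}"
  shows "(\<Sum>i<n. \<Sum>j<n. f (p i) (q j)) = (\<Sum>i<n. \<Sum>j<n. f i j)"
proof -
  have "(\<Sum>j<n. f i (q j)) = (\<Sum>j<n. f i j)" for i
    using sum.permute[OF assms(2), of "f i"] by (simp add: comp_def)
  then show ?thesis
    using sum.permute[OF assms(1), of "\<lambda>i. \<Sum>j<n. f i j"] by (simp add: comp_def)
qed

text \<open>\<open>refl_coeff\<close> only tests its indices for equality, so it commutes with
  permutation matrices, and an identity for one pattern carries over to its whole orbit.\<close>

lemma refl_conj_permuted:
  assumes "p permutes {..<4}" "q permutes {..<4}"
  shows "refl_conj M (p a) (q b) = refl_conj (\<lambda>(i,j). M (p i, q j)) a b"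
proof -
  have coeff: "refl_coeff (p i) (p j) = refl_coeff i j" "refl_coeff (q i) (q j) = refl_coeff i j" for i j
    using assms by (auto simp: refl_coeff_def dest: permutes_inj injD)
  have "refl_conj M (p a) (q b) =
      (\<Sum>i<4. \<Sum>j<4. refl_coeff (p a) (p i) * refl_coeff (q b) (q j) * M (p i, q j))"
    unfolding refl_conj_def
    by (rule sum_permuted[OF assms, symmetric])
  then show ?thesis by (simp add: refl_conj_def coeff)
qed

lemma refl_conj_ray:
  assumes "(c,d) \<in> ray_patterns" "p permutes {..<4}" "q permutes {..<4}" "a < 4" "b < 4"
  shows "refl_conj (ray c p q) (p a) (q b) = of_bool (d a b)"
proof -
  have "refl_conj (ray c p q) (p a) (q b) = refl_conj (\<lambda>(i,j). of_bool (c i j)) a b"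
    unfolding refl_conj_permuted[OF assms(2,3)] ray_def
    using permutes_inverses[OF assms(2)] permutes_inverses[OF assms(3)] by simp
  then show ?thesis using refl_conj_pattern[OF assms(1,4,5)] by simp
qed

lemma refl_conj_linear_fun: "linear_fun (\<lambda>M. refl_conj M a b)"
  by (rule linear_funI)
    (simp add: refl_conj_def algebra_simps sum.distrib sum_distrib_left)

text \<open>The Farkas lemma for the 32 functionals \<open>M (i,j)\<close> and
  \<open>refl_conj M i j\<close>: the weights of the former make up \<open>P\<close>, those of the
  latter \<open>Q\<close>. The assumption on \<open>S\<close> is nonnegativity on the rays, and
  \<open>nonneg_on_cone\<close> extends it to the cone.\<close>

lemma refl_decomposition:
  fixes S :: "nat \<times> nat \<Rightarrow> real"
  assumes S: "\<And>c d p q. (c,d) \<in> ray_patterns \<Longrightarrow> p permutes {..<4} \<Longrightarrow> q permutes {..<4} \<Longrightarrow>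
    0 \<le> (\<Sum>i<4. \<Sum>j<4. of_bool (c i j) * S (p i, q j))"
  shows "\<exists>P Q. (\<forall>i<4. \<forall>j<4. 0 \<le> P (i,j) \<and> 0 \<le> Q (i,j) \<and> S (i,j) = P (i,j) + refl_conj Q i j)"
proof -
  define K where "K = (UNIV :: bool set) \<times> {..<4::nat} \<times> {..<4::nat}"
  define a where "a = (\<lambda>(t,i,j) M. if t then M (i,j) else refl_conj M i j)"
  define b where "b = (\<lambda>M. \<Sum>i<4. \<Sum>j<4. S (i,j) * M (i,j))"
  define G where "G = {ray c p q | c d p q. (c,d) \<in> ray_patterns \<and> p permutes {..<4} \<and> q permutes {..<4}}"
  have finite: "finite K" by (simp add: K_def)
  have lin_a: "linear_fun (a k)" for k
  proof (cases k)
    case (fields t i j)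
    then show ?thesis
      by (cases t) (auto simp: a_def refl_conj_linear_fun intro: linear_funI)
  qed
  have lin_b: "linear_fun b"
    by (rule linear_funI) (simp add: b_def algebra_simps sum.distrib sum_distrib_left)
  have a_nonneg: "(\<forall>k\<in>K. 0 \<le> a k M) \<longleftrightarrow> (\<forall>i<4. \<forall>j<4. 0 \<le> M (i,j) \<and> 0 \<le> refl_conj M i j)" for M
    by (force simp: K_def a_def)
  have "0 \<le> b M" if M: "\<And>k. k \<in> K \<Longrightarrow> 0 \<le> a k M" for M
  proof (rule nonneg_on_cone[of K a b G, OF finite lin_a lin_b _ _ _ M])
    show "0 \<le> b x" if "\<And>k. k \<in> K \<Longrightarrow> a k x = 0" for x
    proof -
      have "x (i,j) = 0" if "i < 4" "j < 4" for i j
        using \<open>\<And>k. k \<in> K \<Longrightarrow> a k x = 0\<close>[of "(True,i,j)"] that by (simp add: K_def a_def)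
      then show ?thesis by (simp add: b_def)
    qed
    show "0 \<le> b g" if gG: "g \<in> G" for g
    proof -
      obtain c d p q where g: "g = ray c p q" "(c,d) \<in> ray_patterns" "p permutes {..<4}" "q permutes {..<4}"
        using gG unfolding G_def by blast
      have "b g = (\<Sum>i<4. \<Sum>j<4. S (p i, q j) * g (p i, q j))"
        unfolding b_def by (rule sum_permuted[OF g(3,4), symmetric])
      also have "\<dots> = (\<Sum>i<4. \<Sum>j<4. of_bool (c i j) * S (p i, q j))"
        using permutes_inverses[OF g(3)] permutes_inverses[OF g(4)]
        by (simp add: g(1) ray_def mult.commute)
      finally show ?thesis using S[OF g(2-4)] by simp
    qed
    fix x k
    assume x: "\<And>k. k \<in> K \<Longrightarrow> 0 \<le> a k x" and k: "k \<in> K" "a k x \<noteq> 0"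
    have nonneg: "0 \<le> x (i,j) \<and> 0 \<le> refl_conj x i j" if "i < 4" "j < 4" for i j
      using x a_nonneg that by blast
    \<comment> \<open>If all entries of \<open>x\<close> were zero, its conjugate would vanish too,
      and with it every functional, including \<open>a k\<close>.\<close>
    have "\<exists>i<4. \<exists>j<4. x (i,j) \<noteq> 0"
    proof (rule ccontr)
      assume "\<not> ?thesis"
      then have "a k x = 0" using k(1) by (auto simp: K_def a_def refl_conj_def)
      with k(2) show False by simp
    qed
    from support_contains_pattern[OF nonneg this]
    obtain c d p q where cd: "(c,d) \<in> ray_patterns" and pq: "p permutes {..<4}" "q permutes {..<4}"
      and supp: "\<And>i j. i < 4 \<Longrightarrow> j < 4 \<Longrightarrow> (c i j \<longrightarrow> x (p i, q j) \<noteq> 0) \<and>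
        (d i j \<longrightarrow> refl_conj x (p i) (q j) \<noteq> 0)"
      by blast
    have inv_pq: "p (inv_into UNIV p i) = i" "q (inv_into UNIV q i) = i" for i
      using permutes_inverses[OF pq(1)] permutes_inverses[OF pq(2)] by auto
    have inv4: "inv_into UNIV p i < 4" "inv_into UNIV q i < 4" if "i < 4" for i
      using permutes_in_image[OF permutes_inv[OF pq(1)], of i]
        permutes_in_image[OF permutes_inv[OF pq(2)], of i] that by auto
    define g where "g = ray c p q"
    have g: "g (i,j) = of_bool (c (inv_into UNIV p i) (inv_into UNIV q j))" for i j
      by (simp add: g_def ray_def)
    have gr: "refl_conj g i j = of_bool (d (inv_into UNIV p i) (inv_into UNIV q j))" if "i < 4" "j < 4" for i j
      using refl_conj_ray[OF cd pq inv4(1)[OF that(1)] inv4(2)[OF that(2)]] by (simp add: inv_pq g_def)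
    have supp': "(c (inv_into UNIV p i) (inv_into UNIV q j) \<longrightarrow> x (i, j) \<noteq> 0) \<and>
        (d (inv_into UNIV p i) (inv_into UNIV q j) \<longrightarrow> refl_conj x i j \<noteq> 0)" if "i < 4" "j < 4" for i j
      using supp[OF inv4(1)[OF that(1)] inv4(2)[OF that(2)]] by (simp add: inv_pq)
    show "\<exists>g\<in>G. (\<forall>k\<in>K. 0 \<le> a k g) \<and> (\<exists>k\<in>K. a k g \<noteq> 0) \<and> (\<forall>k\<in>K. a k x = 0 \<longrightarrow> a k g = 0)"
    proof (intro bexI[of _ g] conjI)
      show "g \<in> G" using cd pq by (auto simp: G_def g_def)
      show "\<forall>k\<in>K. 0 \<le> a k g" by (auto simp: K_def a_def g gr)
      \<comment> \<open>All four patterns contain position \<open>(0,0)\<close>, so the entry of the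
        ray at \<open>(p 0, q 0)\<close> is nonzero.\<close>
      have "c 0 0" using cd by (auto simp: ray_patterns_def)
      moreover have "p 0 < 4" "q 0 < 4"
        using permutes_in_image[OF pq(1), of 0] permutes_in_image[OF pq(2), of 0] by auto
      ultimately show "\<exists>k\<in>K. a k g \<noteq> 0"
        using permutes_inverses[OF pq(1)] permutes_inverses[OF pq(2)]
        by (intro bexI[of _ "(True, p 0, q 0)"]) (auto simp: K_def a_def g)
      show "\<forall>k\<in>K. a k x = 0 \<longrightarrow> a k g = 0"
        using supp' by (auto simp: K_def a_def g gr)
    qed
  qed
  note b_nonneg = this
  have "\<exists>w. (\<forall>k\<in>K. 0 \<le> w k) \<and> (\<forall>x. b x = (\<Sum>k\<in>K. w k * a k x))"
  proof (rule farkas[OF finite lin_a lin_b])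
    show "0 \<le> b x" if "\<And>k. k \<in> K \<Longrightarrow> 0 \<le> a k x" for x
      using that by (rule b_nonneg)
  qed
  then
  obtain w where w: "\<forall>k\<in>K. 0 \<le> w k" "\<forall>x. b x = (\<Sum>k\<in>K. w k * a k x)"
    by (elim exE conjE)
  define P where "P = (\<lambda>(i,j). w (True,i,j))"
  define Q where "Q = (\<lambda>(i,j). w (False,i,j))"
  have b: "b x = (\<Sum>i<4. \<Sum>j<4. P (i,j) * x (i,j)) + (\<Sum>i<4. \<Sum>j<4. Q (i,j) * refl_conj x i j)" for x
    unfolding w(2)[rule_format] K_def by (simp add: sum.cartesian_product' UNIV_bool a_def P_def Q_def)
  have sum_unit: "(\<Sum>k<4. \<Sum>l<4. f (k,l) * of_bool ((k,l) = (i,j))) = f (i,j)" if "i < 4" "j < 4"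
    for f :: "nat \<times> nat \<Rightarrow> real" and i j
  proof -
    have "(\<Sum>k<4. \<Sum>l<4. f (k,l) * of_bool ((k,l) = (i,j))) =
        (\<Sum>z\<in>{..<4}\<times>{..<4}. if z = (i,j) then f z else 0)"
      unfolding sum.cartesian_product by (intro sum.cong) auto
    also have "\<dots> = f (i,j)" using that by (subst sum.delta) auto
    finally show ?thesis .
  qed
  have "0 \<le> P (i,j) \<and> 0 \<le> Q (i,j) \<and> S (i,j) = P (i,j) + refl_conj Q i j" if "i < 4" "j < 4" for i j
  proof -
    \<comment> \<open>At a matrix unit the functional identity reads off one entry of
      \<open>S\<close>. The conjugate of \<open>e\<close> has entries
      \<open>refl_coeff i k * refl_coeff j l\<close>, so the weights \<open>Q\<close> contribute
      exactly \<open>refl_conj Q i j\<close>.\<close>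
    define e where "e = (\<lambda>z. of_bool (z = (i,j)) :: real)"
    have "refl_conj e k l = refl_coeff i k * refl_coeff j l" for k l
      unfolding refl_conj_def e_def
      using sum_unit[OF that, of "\<lambda>(i,j). refl_coeff k i * refl_coeff l j"]
      by (simp add: refl_coeff_def)
    then have "S (i,j) = P (i,j) + refl_conj Q i j"
      using b[of e] sum_unit[OF that, of S] sum_unit[OF that, of P]
      by (simp add: b_def e_def refl_conj_def mult_ac)
    then show ?thesis using w(1) that by (auto simp: K_def P_def Q_def)
  qed
  then show ?thesis by blast
qed

text \<open>\<open>refl_coeff\<close> is symmetric, hence conjugation by it is self-adjoint for the
  entrywise pairing.\<close>

lemma refl_conj_adjoint:
  "(\<Sum>i<4. \<Sum>j<4. A (i,j) * refl_conj B i j) = (\<Sum>k<4. \<Sum>l<4. refl_conj A k l * B (k,l))"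
proof -
  let ?I = "{..<4::nat} \<times> {..<4::nat}"
  define w where "w = (\<lambda>(i,j) (k,l). refl_coeff i k * refl_coeff j l)"
  have sym: "w x y = w y x" for x y
    by (auto simp: w_def refl_coeff_def split: prod.splits)
  have pairs: "(\<Sum>i<4. \<Sum>j<4. f (i,j)) = (\<Sum>z\<in>?I. f z)" for f :: "nat \<times> nat \<Rightarrow> real"
    by (simp add: sum.cartesian_product case_prod_unfold)
  have conj: "refl_conj C i j = (\<Sum>y\<in>?I. w (i,j) y * C y)" for C i j
    unfolding refl_conj_def pairs[symmetric] by (simp add: w_def)
  have "(\<Sum>i<4. \<Sum>j<4. A (i,j) * refl_conj B i j) = (\<Sum>x\<in>?I. \<Sum>y\<in>?I. A x * (w x y * B y))"
    unfolding conj sum_distrib_left by (rule pairs)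
  also have "\<dots> = (\<Sum>y\<in>?I. \<Sum>x\<in>?I. A x * (w x y * B y))"
    by (rule sum.swap)
  also have "\<dots> = (\<Sum>y\<in>?I. (\<Sum>x\<in>?I. w y x * A x) * B y)"
    unfolding sum_distrib_right by (intro sum.cong refl) (simp add: sym mult_ac)
  also have "\<dots> = (\<Sum>k<4. \<Sum>l<4. refl_conj A k l * B (k,l))"
    unfolding conj by (rule pairs[symmetric])
  finally show ?thesis .
qed

text \<open>Self-adjointness moves the reflection from \<open>Q\<close> to the pattern
  \<open>c\<close>, where it produces the partner pattern \<open>d\<close>. What remains are sums of
  entries of \<open>P\<close> and of \<open>Q\<close>.\<close>

lemma pattern_sum_nonneg:
  fixes S P Q :: "nat \<times> nat \<Rightarrow> real"
  assumes PQ: "\<And>i j. i < 4 \<Longrightarrow> j < 4 \<Longrightarrow> 0 \<le> P (i,j) \<and> 0 \<le> Q (i,j) \<and> S (i,j) = P (i,j) + refl_conj Q i j"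
    and cd: "(c,d) \<in> ray_patterns" and pq: "p permutes {..<4}" "q permutes {..<4}"
  shows "0 \<le> (\<Sum>i<4. \<Sum>j<4. of_bool (c i j) * S (p i, q j))"
proof -
  have less: "p i < 4" "q i < 4" if "i < 4" for i
    using permutes_in_image[OF pq(1), of i] permutes_in_image[OF pq(2), of i] that by auto
  define Q' where "Q' = (\<lambda>(i,j). Q (p i, q j))"
  have "(\<Sum>i<4. \<Sum>j<4. of_bool (c i j) * S (p i, q j)) =
      (\<Sum>i<4. \<Sum>j<4. of_bool (c i j) * P (p i, q j)) +
      (\<Sum>i<4. \<Sum>j<4. of_bool (c i j) * refl_conj Q' i j)"
    unfolding sum.distrib[symmetric] distrib_left[symmetric] Q'_def
    by (intro sum.cong refl) (simp add: PQ less refl_conj_permuted[OF pq])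
  also have "(\<Sum>i<4. \<Sum>j<4. of_bool (c i j) * refl_conj Q' i j) =
      (\<Sum>k<4. \<Sum>l<4. of_bool (d k l) * Q' (k,l))"
    using refl_conj_adjoint[of "\<lambda>(i,j). of_bool (c i j)" Q'] by (simp add: refl_conj_pattern[OF cd])
  finally show ?thesis
    using PQ less by (auto simp: Q'_def intro!: sum_nonneg add_nonneg_nonneg mult_nonneg_nonneg)
qed

lemma pattern_sums_iff:
  fixes S :: "nat \<times> nat \<Rightarrow> real"
  shows "(\<forall>(c,d)\<in>ray_patterns. 0 \<le> (\<Sum>i<4. \<Sum>j<4. of_bool (c i j) * S (p i, q j))) \<longleftrightarrow>
    S (p 0, q 0) + S (p 0, q 1) + S (p 1, q 0) + S (p 1, q 1) \<ge> 0 \<and>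
    S (p 0, q 0) + S (p 1, q 1) + S (p 2, q 2) + S (p 3, q 3) \<ge> 0 \<and>
    S (p 0, q 0) + S (p 1, q 1) + S (p 2, q 2) + S (p 3, q 0) + S (p 3, q 1) + S (p 3, q 2) \<ge> 0 \<and>
    S (p 0, q 0) + S (p 1, q 1) + S (p 2, q 2) + S (p 0, q 3) + S (p 1, q 3) + S (p 2, q 3) \<ge> 0"
  unfolding ray_patterns_def sum_lessThan_4 by (simp add: algebra_simps)

text \<open>Reversal is a permutation of the indices. It arises because transposition sends the
  index \<open>i\<close> to the reflection row \<open>3 - i\<close>.\<close>

lemma refl_conj_reverse:
  assumes "i < 4" "j < 4"
  shows "refl_conj M (3 - i) (3 - j) = refl_conj (\<lambda>(i,j). M (3 - i, 3 - j)) i j"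
proof -
  \<comment> \<open>A permutation in the sense of \<open>permutes\<close> must fix everything
    outside the set, which truncated subtraction \<open>3 - i\<close> does not.\<close>
  define rev where "rev = (\<lambda>i::nat. if i < 4 then 3 - i else i)"
  have "rev permutes {..<4}"
    by (rule bij_imp_permutes) (auto simp: rev_def bij_betw_def inj_on_def image_def lessThan_4)
  then have "refl_conj M (rev i) (rev j) = refl_conj (\<lambda>(i,j). M (rev i, rev j)) i j"
    using refl_conj_permuted by blast
  also have "\<dots> = refl_conj (\<lambda>(i,j). M (3 - i, 3 - j)) i j"
    unfolding refl_conj_def by (intro sum.cong refl) (simp add: rev_def)
  finally show ?thesis using assms by (simp add: rev_def)
qed

section \<open>Pauli matrices and decomposability\<close>

lemma less_2_disj: "i < 2 \<Longrightarrow> i = 0 \<or> i = (1::nat)"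
  by linarith

lemma sum_lessThan_2: "(\<Sum>i<2. f i) = f 0 + f (1::nat)"
  by (simp add: numeral_2_eq_2)

lemma pauli_index:
  "pauli k $$ (0,0) = (if k = 0 \<or> k = 2 then 1 else 0)"
  "pauli k $$ (0,Suc 0) = (if k = 0 \<or> k = 2 then 0 else if k = 1 then 1 else - \<i>)"
  "pauli k $$ (Suc 0,0) = (if k = 0 \<or> k = 2 then 0 else if k = 1 then 1 else \<i>)"
  "pauli k $$ (Suc 0,Suc 0) = (if k = 0 then 1 else if k = 2 then - 1 else 0)"
  by (simp_all add: pauli_def mat_of_rows_list_def)

lemma pauli_dim [simp]: "dim_row (pauli k) = 2" "dim_col (pauli k) = 2"
  by (simp_all add: pauli_def mat_of_rows_list_def)

lemma Dmat_carrier [simp]: "Dmat \<in> carrier_mat 4 4"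
  by (rule carrier_matI) (simp_all add: Dmat_def mat_of_rows_list_def)

lemma Dmat_index:
  assumes "i < 4" "j < 4"
  shows "Dmat $$ (i,j) = (if i = 0 \<or> j = 0 \<or> i = j then 1/2 else - 1/2)"
  using less_4_disj[OF assms(1)] less_4_disj[OF assms(2)]
  by (elim disjE) (simp_all add: Dmat_def mat_of_rows_list_def)

text \<open>Paired with \<open>X $$ (a,b)\<close> and summed, the left side is an entry of the trace
  of \<open>pauli i * X\<close> times \<open>pauli i\<close>, while the right side is a combination
  of the conjugations \<open>pauli k * X * pauli k\<close>. The identity is checked entry by
  entry.\<close>

lemma pauli_fierz:
  assumes "i < 4" "a < 2" "b < 2" "r < 2" "c < 2"
  shows "pauli i $$ (b,a) * pauli i $$ (r,c) =
    (\<Sum>k<4. of_real (Dmat $$ (i,k)) * (pauli k $$ (r,a) * pauli k $$ (b,c)))"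
  using less_4_disj[OF assms(1)] assms(2-)[THEN less_2_disj]
  unfolding sum_lessThan_4
  by (elim disjE) (simp_all add: Dmat_index pauli_index)

text \<open>The same for the transpose of \<open>pauli i * X * pauli i\<close>. For
  \<open>i = 0\<close> the only negative coefficient belongs to the antisymmetric
  \<open>pauli 3\<close>. Multiplying by \<open>pauli i\<close> moves it to \<open>3 - i\<close>,
  since the product of \<open>pauli i\<close> and \<open>pauli 3\<close> is
  \<open>pauli (3 - i)\<close> up to phase.\<close>

lemma pauli_fierz_transpose:
  assumes "i < 4" "a < 2" "b < 2" "r < 2" "c < 2"
  shows "pauli i $$ (c,a) * pauli i $$ (b,r) =
    (\<Sum>k<4. of_real (refl_coeff (3 - i) k) * (pauli k $$ (r,a) * pauli k $$ (b,c)))"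
  using less_4_disj[OF assms(1)] assms(2-)[THEN less_2_disj]
  unfolding sum_lessThan_4
  by (elim disjE) (simp_all add: refl_coeff_def pauli_index)

lemma pauli_hermitian:
  assumes "r < 2" "c < 2"
  shows "cnj (pauli k $$ (r,c)) = pauli k $$ (c,r)"
  using assms[THEN less_2_disj] by (elim disjE) (simp_all add: pauli_index)

abbreviation pauli2 :: "nat \<Rightarrow> nat \<Rightarrow> complex mat" where
  "pauli2 k l \<equiv> kron (pauli k) (pauli l)"

lemma pauli2_index:
  "r < 4 \<Longrightarrow> c < 4 \<Longrightarrow> pauli2 k l $$ (r,c) =
    pauli k $$ (r div 2, c div 2) * pauli l $$ (r mod 2, c mod 2)"
  by (simp add: kron_def)

lemma pauli2_dim [simp]: "dim_row (pauli2 k l) = 4" "dim_col (pauli2 k l) = 4"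
  by (simp_all add: kron_def)

lemma pauli2_hermitian:
  assumes "r < 4" "c < 4"
  shows "cnj (pauli2 k l $$ (r,c)) = pauli2 k l $$ (c,r)"
  using assms by (simp add: pauli2_index pauli_hermitian)

lemma pauli2_fierz:
  assumes "i < 4" "j < 4" "a < 4" "b < 4" "r < 4" "c < 4"
  shows "pauli2 i j $$ (b,a) * pauli2 i j $$ (r,c) =
    (\<Sum>k<4. \<Sum>l<4. of_real (Dmat $$ (i,k) * Dmat $$ (j,l)) * (pauli2 k l $$ (r,a) * pauli2 k l $$ (b,c)))"
proof -
  have "pauli2 i j $$ (b,a) * pauli2 i j $$ (r,c) =
      (pauli i $$ (b div 2, a div 2) * pauli i $$ (r div 2, c div 2)) *
      (pauli j $$ (b mod 2, a mod 2) * pauli j $$ (r mod 2, c mod 2))"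
    using assms by (simp add: pauli2_index)
  also have "\<dots> =
      (\<Sum>k<4. of_real (Dmat $$ (i,k)) * (pauli k $$ (r div 2, a div 2) * pauli k $$ (b div 2, c div 2))) *
      (\<Sum>l<4. of_real (Dmat $$ (j,l)) * (pauli l $$ (r mod 2, a mod 2) * pauli l $$ (b mod 2, c mod 2)))"
    using assms by (intro arg_cong2[where f = "(*)"] pauli_fierz) simp_all
  also have "\<dots> = (\<Sum>k<4. \<Sum>l<4.
      (of_real (Dmat $$ (i,k)) * (pauli k $$ (r div 2, a div 2) * pauli k $$ (b div 2, c div 2))) *
      (of_real (Dmat $$ (j,l)) * (pauli l $$ (r mod 2, a mod 2) * pauli l $$ (b mod 2, c mod 2))))"
    by (rule sum_product)
  also have "\<dots> = (\<Sum>k<4. \<Sum>l<4. of_real (Dmat $$ (i,k) * Dmat $$ (j,l)) *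
      (pauli2 k l $$ (r,a) * pauli2 k l $$ (b,c)))"
    using assms by (simp add: pauli2_index mult_ac)
  finally show ?thesis .
qed

lemma pauli2_fierz_transpose:
  assumes "i < 4" "j < 4" "a < 4" "b < 4" "r < 4" "c < 4"
  shows "pauli2 i j $$ (c,a) * pauli2 i j $$ (b,r) =
    (\<Sum>k<4. \<Sum>l<4. of_real (refl_coeff (3 - i) k * refl_coeff (3 - j) l) *
      (pauli2 k l $$ (r,a) * pauli2 k l $$ (b,c)))"
proof -
  have "pauli2 i j $$ (c,a) * pauli2 i j $$ (b,r) =
      (pauli i $$ (c div 2, a div 2) * pauli i $$ (b div 2, r div 2)) *
      (pauli j $$ (c mod 2, a mod 2) * pauli j $$ (b mod 2, r mod 2))"
    using assms by (simp add: pauli2_index)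
  also have "\<dots> =
      (\<Sum>k<4. of_real (refl_coeff (3 - i) k) * (pauli k $$ (r div 2, a div 2) * pauli k $$ (b div 2, c div 2))) *
      (\<Sum>l<4. of_real (refl_coeff (3 - j) l) * (pauli l $$ (r mod 2, a mod 2) * pauli l $$ (b mod 2, c mod 2)))"
    using assms by (intro arg_cong2[where f = "(*)"] pauli_fierz_transpose) simp_all
  also have "\<dots> = (\<Sum>k<4. \<Sum>l<4.
      (of_real (refl_coeff (3 - i) k) * (pauli k $$ (r div 2, a div 2) * pauli k $$ (b div 2, c div 2))) *
      (of_real (refl_coeff (3 - j) l) * (pauli l $$ (r mod 2, a mod 2) * pauli l $$ (b mod 2, c mod 2))))"
    by (rule sum_product)
  also have "\<dots> = (\<Sum>k<4. \<Sum>l<4. of_real (refl_coeff (3 - i) k * refl_coeff (3 - j) l) *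
      (pauli2 k l $$ (r,a) * pauli2 k l $$ (b,c)))"
    using assms by (simp add: pauli2_index mult_ac)
  finally show ?thesis .
qed

text \<open>There is no conjugation in the sum, so for the antisymmetric \<open>pauli 3\<close>
  paired with itself it equals -2. Squaring removes the sign.\<close>

lemma pauli_orthogonal:
  assumes "k < 4" "l < 4"
  shows "(\<Sum>r<2. \<Sum>a<2. pauli k $$ (r,a) * pauli l $$ (r,a))\<^sup>2 = 4 * of_bool (k = l)"
  using assms[THEN less_4_disj] unfolding sum_lessThan_2
  by (elim disjE) (simp_all add: pauli_index power2_eq_square)

lemma pauli2_orthogonal:
  assumes "k < 4" "l < 4" "k' < 4" "l' < 4"
  shows "(\<Sum>r<4. \<Sum>a<4. pauli2 k l $$ (r,a) * pauli2 k' l' $$ (r,a))\<^sup>2 =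
    16 * of_bool (k = k' \<and> l = l')"
proof -
  define t where "t k k' = (\<Sum>r<2. \<Sum>a<2. pauli k $$ (r,a) * pauli k' $$ (r,a))" for k k'
  have "(\<Sum>r<4. \<Sum>a<4. pauli2 k l $$ (r,a) * pauli2 k' l' $$ (r,a)) = t k k' * t l l'"
    unfolding t_def sum_lessThan_4 sum_lessThan_2
    by (simp add: pauli2_index algebra_simps)
  then show ?thesis using assms by (simp add: power_mult_distrib t_def pauli_orthogonal)
qed

section \<open>Quadratic forms and Kraus maps\<close>

lemma sum_lessThan_mult:
  "(\<Sum>i<k * n. f i) = (\<Sum>a<k. \<Sum>p<n. f (a * n + p))" for n :: nat
proof -
  have "sum f {a * n..<a * n + n} = (\<Sum>p<n. f (a * n + p))" for a
    using sum.shift_bounds_nat_ivl[of f 0 "a * n" n] by (simp add: atLeast0LessThan add.commute)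
  then show ?thesis using sum.nat_group[of f n k] by simp
qed

lemma mult_add_less: "a < k \<Longrightarrow> p < n \<Longrightarrow> a * n + p < k * (n::nat)"
proof -
  assume "a < k" "p < n"
  then have "a * n + p < Suc a * n" "Suc a * n \<le> k * n" by (simp, simp only: Suc_leI mult_le_mono1)
  then show ?thesis by (rule less_le_trans)
qed

lemma sum_swap_pairs:
  "(\<Sum>p\<in>A. \<Sum>q\<in>B. \<Sum>c\<in>C. \<Sum>d\<in>D. f p q c d) = (\<Sum>c\<in>C. \<Sum>d\<in>D. \<Sum>p\<in>A. \<Sum>q\<in>B. f p q c d)"
  by (simp only: sum.swap[of _ C B] sum.swap[of _ C A] sum.swap[of _ D B] sum.swap[of _ D A])

definition quad_form :: "nat \<Rightarrow> complex mat \<Rightarrow> (nat \<Rightarrow> complex) \<Rightarrow> complex" where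
  "quad_form n A v = (\<Sum>i<n. \<Sum>j<n. cnj (v i) * A $$ (i,j) * v j)"

text \<open>The order on complex numbers already requires equal imaginary parts, so both conditions
  of \<open>psd\<close> become one inequality. Functions instead of vectors make reindexing by
  blocks a matter of sums only.\<close>

lemma psd_iff_quad_form:
  "psd n A \<longleftrightarrow> A \<in> carrier_mat n n \<and> (\<forall>v. 0 \<le> quad_form n A v)"
proof (cases "A \<in> carrier_mat n n")
  case True
  have form: "conjugate v \<bullet> (A *\<^sub>v v) = quad_form n A (\<lambda>i. v $ i)" if "v \<in> carrier_vec n" for v
    using True that unfolding quad_form_def
    by (auto simp: scalar_prod_def sum_distrib_left mult.assoc atLeast0LessThan intro!: sum.cong)
  have "0 \<le> quad_form n A v" if "\<forall>v\<in>carrier_vec n. 0 \<le> conjugate v \<bullet> (A *\<^sub>v v)" for v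
  proof -
    have "quad_form n A (\<lambda>i. vec n v $ i) = quad_form n A v"
      unfolding quad_form_def by (intro sum.cong) auto
    then show ?thesis using that form[of "vec n v"] by (metis vec_carrier)
  qed
  moreover have "psd n A \<longleftrightarrow> (\<forall>v\<in>carrier_vec n. 0 \<le> conjugate v \<bullet> (A *\<^sub>v v))"
    unfolding psd_def less_eq_complex_def using True by (simp add: conj_commute eq_commute[of 0])
  ultimately show ?thesis
    using True form by (metis (no_types))
qed (simp add: psd_def)

lemma quad_form_block:
  "quad_form (k * n) A v = (\<Sum>a<k. \<Sum>b<k. \<Sum>p<n. \<Sum>q<n.
    cnj (v (a * n + p)) * A $$ (a * n + p, b * n + q) * v (b * n + q))"
  unfolding quad_form_def sum_lessThan_mult
  by (rule sum.cong[OF refl], rule sum.swap)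

lemma quad_form_ampl:
  "quad_form (k * n) (ampl k n n T X) v = (\<Sum>a<k. \<Sum>b<k. \<Sum>p<n. \<Sum>q<n.
    cnj (v (a * n + p)) * T (blk n X a b) $$ (p,q) * v (b * n + q))"
  unfolding quad_form_block
  by (intro sum.cong refl) (auto simp: ampl_def mult_add_less)

text \<open>The real weights stand apart from the operators, so nonnegative coefficients need no
  square roots.\<close>

definition kraus_map :: "nat \<Rightarrow> 'z set \<Rightarrow> ('z \<Rightarrow> real) \<Rightarrow> ('z \<Rightarrow> complex mat) \<Rightarrow> complex mat \<Rightarrow> complex mat" where
  "kraus_map n Z w V X = mat n n (\<lambda>(r,c). \<Sum>z\<in>Z. of_real (w z) *
    (\<Sum>a<n. \<Sum>b<n. V z $$ (r,a) * X $$ (a,b) * cnj (V z $$ (c,b))))"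

lemma kraus_map_lin: "lin_map n n (kraus_map n Z w V)"
  unfolding lin_map_def
  by (auto simp: kraus_map_def algebra_simps sum.distrib sum_distrib_left intro!: eq_matI)

text \<open>The quadratic form of the ampliation at \<open>v\<close> is the weighted sum of the
  forms of \<open>X\<close> at the vectors obtained from \<open>v\<close> by the adjoint of
  \<open>V z\<close> in every block.\<close>

lemma completely_positive_kraus_map:
  assumes w: "\<And>z. z \<in> Z \<Longrightarrow> 0 \<le> w z"
  shows "completely_positive n n (kraus_map n Z w V)"
  unfolding completely_positive_def k_positive_def
proof (intro conjI kraus_map_lin allI impI)
  fix k X
  assume X: "psd (k * n) X"
  have "0 \<le> quad_form (k * n) (ampl k n n (kraus_map n Z w V) X) v" for v
  proof -
    define u where "u z i = (\<Sum>q<n. cnj (V z $$ (q, i mod n)) * v (i div n * n + q))" for z i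
    have "quad_form (k * n) (ampl k n n (kraus_map n Z w V) X) v =
      (\<Sum>a<k. \<Sum>b<k. \<Sum>p<n. \<Sum>q<n. \<Sum>z\<in>Z. of_real (w z) * (\<Sum>c<n. \<Sum>d<n.
        cnj (v (a * n + p)) * V z $$ (p,c) * X $$ (a * n + c, b * n + d) * cnj (V z $$ (q,d)) * v (b * n + q)))"
      unfolding quad_form_ampl
      by (intro sum.cong refl) (simp add: kraus_map_def blk_def sum_distrib_left sum_distrib_right mult_ac)
    also have "\<dots> = (\<Sum>z\<in>Z. of_real (w z) * (\<Sum>a<k. \<Sum>b<k. \<Sum>c<n. \<Sum>d<n. \<Sum>p<n. \<Sum>q<n.
        cnj (v (a * n + p)) * V z $$ (p,c) * X $$ (a * n + c, b * n + d) * cnj (V z $$ (q,d)) * v (b * n + q)))"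
      unfolding sum.swap[of _ Z "{..<n}"] sum.swap[of _ Z "{..<k}"] sum_distrib_left[symmetric]
      by (intro sum.cong refl arg_cong2[where f = "(*)"] sum_swap_pairs)
    also have "\<dots> = (\<Sum>z\<in>Z. of_real (w z) * quad_form (k * n) X (u z))"
      unfolding quad_form_block u_def
      by (intro sum.cong refl arg_cong2[where f = "(*)"])
        (simp add: sum_product sum_distrib_left sum_distrib_right mult_ac)
    also have "0 \<le> \<dots>"
      using X w unfolding psd_iff_quad_form
      by (intro sum_nonneg mult_nonneg_nonneg) (auto simp: less_eq_complex_def)
    finally show ?thesis .
  qed
  then show "psd (k * n) (ampl k n n (kraus_map n Z w V) X)"
    by (simp add: psd_iff_quad_form ampl_def)
qed

section \<open>Kraus form of the Pauli diagonal map\<close>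

lemma Dmat_symmetric: "i < 4 \<Longrightarrow> j < 4 \<Longrightarrow> Dmat $$ (i,j) = Dmat $$ (j,i)"
  by (auto simp: Dmat_index)

lemma sum_of_bool_pair:
  fixes f g :: "nat \<Rightarrow> complex"
  assumes "a < 4" "b < 4"
  shows "(\<Sum>p<4. \<Sum>q<4. f p * of_bool (p = a \<and> q = b) * g q) = f a * g b"
  using less_4_disj[OF assms(1)] less_4_disj[OF assms(2)] unfolding sum_lessThan_4
  by (elim disjE) simp_all

lemma spectral_mat_index:
  assumes "\<mu> \<in> carrier_mat 4 4" "k < 4" "l < 4"
  shows "spectral_mat \<mu> $$ (k,l) = (\<Sum>i<4. \<Sum>j<4. Dmat $$ (k,i) * \<mu> $$ (i,j) * Dmat $$ (l,j))"
proof -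
  have dims: "dim_row Dmat = 4" "dim_col Dmat = 4" "dim_row \<mu> = 4" "dim_col \<mu> = 4"
    using assms(1) carrier_matD[OF Dmat_carrier] by auto
  have "spectral_mat \<mu> $$ (k,l) = (\<Sum>j<4. (\<Sum>i<4. Dmat $$ (k,i) * \<mu> $$ (i,j)) * Dmat $$ (l,j))"
    using assms(2,3) unfolding spectral_mat_def
    by (simp add: scalar_prod_def atLeast0LessThan dims)
  also have "\<dots> = (\<Sum>i<4. \<Sum>j<4. Dmat $$ (k,i) * \<mu> $$ (i,j) * Dmat $$ (l,j))"
    unfolding sum_distrib_right by (rule sum.swap)
  finally show ?thesis .
qed

text \<open>The Fierz identity on both tensor factors turns each trace term into Kraus terms.
  Collecting them sandwiches \<open>\<mu>\<close> between two copies of \<open>Dmat\<close>, whose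
  symmetry gives the spectral matrix.\<close>

lemma pauli_diag_map_index:
  assumes \<mu>: "\<mu> \<in> carrier_mat 4 4" and X: "X \<in> carrier_mat 4 4" and rc: "r < 4" "c < 4"
  shows "pauli_diag_map \<mu> X $$ (r,c) = (\<Sum>k<4. \<Sum>l<4. of_real (spectral_mat \<mu> $$ (k,l) / 4) *
    (\<Sum>a<4. \<Sum>b<4. pauli2 k l $$ (r,a) * X $$ (a,b) * pauli2 k l $$ (b,c)))"
proof -
  define G where "G k l a b = pauli2 k l $$ (r,a) * pauli2 k l $$ (b,c)" for k l a b
  have trace: "mtrace (pauli2 i j * X) = (\<Sum>a<4. \<Sum>b<4. pauli2 i j $$ (b,a) * X $$ (a,b))" for i j
    using X unfolding mtrace_def
    by (subst sum.swap) (simp add: scalar_prod_def atLeast0LessThan)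
  have fierz: "(\<Sum>i<4. \<Sum>j<4. of_real (\<mu> $$ (i,j)) * (pauli2 i j $$ (b,a) * pauli2 i j $$ (r,c))) =
      (\<Sum>k<4. \<Sum>l<4. of_real (spectral_mat \<mu> $$ (k,l)) * G k l a b)" if ab: "a < 4" "b < 4" for a b
  proof -
    have "(\<Sum>i<4. \<Sum>j<4. of_real (\<mu> $$ (i,j)) * (pauli2 i j $$ (b,a) * pauli2 i j $$ (r,c))) =
        (\<Sum>i<4. \<Sum>j<4. \<Sum>k<4. \<Sum>l<4. of_real (Dmat $$ (k,i) * \<mu> $$ (i,j) * Dmat $$ (l,j)) * G k l a b)"
      unfolding G_def
      by (intro sum.cong refl)
        (simp add: pauli2_fierz[OF _ _ ab rc] sum_distrib_left Dmat_symmetric[of "_" i for i] mult_ac)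
    also have "\<dots> = (\<Sum>k<4. \<Sum>l<4. of_real (spectral_mat \<mu> $$ (k,l)) * G k l a b)"
      by (subst sum_swap_pairs) (simp add: spectral_mat_index[OF \<mu>] sum_distrib_right)
    finally show ?thesis .
  qed
  have "pauli_diag_map \<mu> X $$ (r,c) = (\<Sum>i<4. \<Sum>j<4. \<Sum>a<4. \<Sum>b<4.
      X $$ (a,b) / 4 * (of_real (\<mu> $$ (i,j)) * (pauli2 i j $$ (b,a) * pauli2 i j $$ (r,c))))"
    using rc by (simp add: pauli_diag_map_def trace sum_distrib_left sum_distrib_right mult_ac)
  also have "\<dots> = (\<Sum>a<4. \<Sum>b<4. \<Sum>i<4. \<Sum>j<4.
      X $$ (a,b) / 4 * (of_real (\<mu> $$ (i,j)) * (pauli2 i j $$ (b,a) * pauli2 i j $$ (r,c))))"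
    by (rule sum_swap_pairs)
  also have "\<dots> = (\<Sum>a<4. \<Sum>b<4. X $$ (a,b) / 4 * (\<Sum>k<4. \<Sum>l<4. of_real (spectral_mat \<mu> $$ (k,l)) * G k l a b))"
    unfolding sum_distrib_left[symmetric] by (intro sum.cong refl) (simp add: fierz)
  also have "\<dots> = (\<Sum>k<4. \<Sum>l<4. \<Sum>a<4. \<Sum>b<4. X $$ (a,b) / 4 * (of_real (spectral_mat \<mu> $$ (k,l)) * G k l a b))"
    unfolding sum_distrib_left by (rule sum_swap_pairs)
  finally show ?thesis
    by (simp add: G_def sum_distrib_left mult_ac)
qed

section \<open>Choi coefficients and the criterion for decomposability\<close>

definition unit_matrix :: "nat \<Rightarrow> nat \<Rightarrow> complex mat" where
  "unit_matrix a b = mat 4 4 (\<lambda>(i,j). of_bool (i = a \<and> j = b))"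

lemma unit_matrix_carrier [simp]: "unit_matrix a b \<in> carrier_mat 4 4"
  by (simp add: unit_matrix_def)

text \<open>The quadratic form of the Choi matrix of \<open>T\<close> at the vectorised
  \<open>pauli2 k l\<close>. Hermiticity of that matrix replaces the conjugate by exchanged
  indices.\<close>

definition choi_coeff :: "(complex mat \<Rightarrow> complex mat) \<Rightarrow> nat \<Rightarrow> nat \<Rightarrow> complex" where
  "choi_coeff T k l = (\<Sum>a<4. \<Sum>b<4. \<Sum>r<4. \<Sum>c<4.
    T (unit_matrix a b) $$ (r,c) * (pauli2 k l $$ (r,a) * pauli2 k l $$ (b,c)))"

text \<open>\<open>X\<close> is the unnormalised projection onto the maximally entangled vector. Its
  blocks are the matrix units, so its ampliation is the Choi matrix.\<close>

lemma choi_coeff_nonneg: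
  assumes "completely_positive 4 4 T"
  shows "0 \<le> choi_coeff T k l"
proof -
  define X where "X = mat (4 * 4) (4 * 4) (\<lambda>(i,j). of_bool (i mod 4 = i div 4 \<and> j mod 4 = j div 4) :: complex)"
  have X: "X $$ (a * 4 + p, b * 4 + q) = of_bool (p = a \<and> q = b)" if "a < 4" "b < 4" "p < 4" "q < 4" for a b p q
    using that mult_add_less[of _ 4 _ 4] by (simp add: X_def)
  have "0 \<le> quad_form (4 * 4) X v" for v
  proof -
    define s where "s = (\<Sum>a<4. v (a * 4 + a))"
    have "quad_form (4 * 4) X v = (\<Sum>a<4. \<Sum>b<4. cnj (v (a * 4 + a)) * v (b * 4 + b))"
    proof -
      have "(\<Sum>p<4. \<Sum>q<4. cnj (v (a * 4 + p)) * X $$ (a * 4 + p, b * 4 + q) * v (b * 4 + q)) =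
        cnj (v (a * 4 + a)) * v (b * 4 + b)" if "a < 4" "b < 4" for a b
      proof -
        have "(\<Sum>p<4. \<Sum>q<4. cnj (v (a * 4 + p)) * X $$ (a * 4 + p, b * 4 + q) * v (b * 4 + q)) =
            (\<Sum>p<4. \<Sum>q<4. cnj (v (a * 4 + p)) * of_bool (p = a \<and> q = b) * v (b * 4 + q))"
          by (intro sum.cong refl) (simp add: X that)
        then show ?thesis using sum_of_bool_pair[OF that] by simp
      qed
      then show ?thesis unfolding quad_form_block by simp
    qed
    also have "\<dots> = cnj s * s"
      unfolding s_def cnj_sum sum_product ..
    finally show ?thesis by (simp add: less_eq_complex_def mult.commute)
  qed
  then have "psd (4 * 4) X" by (simp add: psd_iff_quad_form X_def)
  then have "psd (4 * 4) (ampl 4 4 4 T X)"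
    using assms unfolding completely_positive_def k_positive_def by blast
  then have "0 \<le> quad_form (4 * 4) (ampl 4 4 4 T X) (\<lambda>i. pauli2 k l $$ (i div 4, i mod 4))"
    by (simp add: psd_iff_quad_form)
  also have "blk 4 X a b = unit_matrix a b" if "a < 4" "b < 4" for a b
    using that by (auto simp: blk_def unit_matrix_def X)
  then have "quad_form (4 * 4) (ampl 4 4 4 T X) (\<lambda>i. pauli2 k l $$ (i div 4, i mod 4)) = choi_coeff T k l"
    unfolding quad_form_ampl choi_coeff_def by (simp add: pauli2_hermitian mult_ac)
  finally show ?thesis .
qed

text \<open>Orthogonality keeps a single term of the Kraus form, with weight \<open>1/4\<close>
  times 16.\<close>

lemma choi_coeff_pauli_diag_map:
  assumes \<mu>: "\<mu> \<in> carrier_mat 4 4" and "k < 4" "l < 4"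
  shows "choi_coeff (pauli_diag_map \<mu>) k l = of_real (4 * spectral_mat \<mu> $$ (k,l))"
proof -
  let ?S = "\<lambda>k l. complex_of_real (spectral_mat \<mu> $$ (k,l))"
  have entry: "pauli_diag_map \<mu> (unit_matrix a b) $$ (r,c) =
      (\<Sum>k<4. \<Sum>l<4. ?S k l / 4 * (pauli2 k l $$ (r,a) * pauli2 k l $$ (b,c)))"
    if "a < 4" "b < 4" "r < 4" "c < 4" for a b r c
  proof -
    have "(\<Sum>i<4. \<Sum>j<4. pauli2 k l $$ (r,i) * unit_matrix a b $$ (i,j) * pauli2 k l $$ (j,c)) =
        pauli2 k l $$ (r,a) * pauli2 k l $$ (b,c)" for k l
      using less_4_disj[OF that(1)] less_4_disj[OF that(2)] unfolding sum_lessThan_4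
      by (elim disjE) (simp_all add: unit_matrix_def)
    then show ?thesis using that by (simp add: pauli_diag_map_index[OF \<mu>])
  qed
  have square: "(\<Sum>a<4. \<Sum>b<4. \<Sum>r<4. \<Sum>c<4. (pauli2 k' l' $$ (r,a) * pauli2 k' l' $$ (b,c)) *
      (pauli2 k l $$ (r,a) * pauli2 k l $$ (b,c))) = 16 * of_bool (k = k' \<and> l = l')"
    if "k' < 4" "l' < 4" for k' l'
  proof -
    have "(\<Sum>a<4. \<Sum>b<4. \<Sum>r<4. \<Sum>c<4. (pauli2 k' l' $$ (r,a) * pauli2 k' l' $$ (b,c)) *
      (pauli2 k l $$ (r,a) * pauli2 k l $$ (b,c))) =
      (\<Sum>a<4. \<Sum>r<4. pauli2 k l $$ (r,a) * pauli2 k' l' $$ (r,a)) *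
      (\<Sum>b<4. \<Sum>c<4. pauli2 k l $$ (b,c) * pauli2 k' l' $$ (b,c))"
      unfolding sum_product by (intro sum.cong refl) (simp add: mult_ac)
    also have "(\<Sum>a<4. \<Sum>r<4. pauli2 k l $$ (r,a) * pauli2 k' l' $$ (r,a)) =
        (\<Sum>r<4. \<Sum>a<4. pauli2 k l $$ (r,a) * pauli2 k' l' $$ (r,a))"
      by (rule sum.swap)
    finally show ?thesis
      using pauli2_orthogonal[OF assms(2,3) that] by (simp add: power2_eq_square)
  qed
  let ?g = "\<lambda>k l a b r c. pauli2 k l $$ (r,a) * pauli2 k l $$ (b,c)"
  have "choi_coeff (pauli_diag_map \<mu>) k l = (\<Sum>a<4. \<Sum>b<4. \<Sum>r<4. \<Sum>c<4. \<Sum>k'<4. \<Sum>l'<4.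
      ?S k' l' / 4 * (?g k' l' a b r c * ?g k l a b r c))"
    unfolding choi_coeff_def by (intro sum.cong refl) (simp add: entry sum_distrib_left sum_distrib_right mult_ac)
  also have "\<dots> = (\<Sum>a<4. \<Sum>b<4. \<Sum>k'<4. \<Sum>l'<4. \<Sum>r<4. \<Sum>c<4.
      ?S k' l' / 4 * (?g k' l' a b r c * ?g k l a b r c))"
    by (rule sum.cong[OF refl], rule sum.cong[OF refl], rule sum_swap_pairs)
  also have "\<dots> = (\<Sum>k'<4. \<Sum>l'<4. \<Sum>a<4. \<Sum>b<4. \<Sum>r<4. \<Sum>c<4.
      ?S k' l' / 4 * (?g k' l' a b r c * ?g k l a b r c))"
    by (rule sum_swap_pairs)
  also have "\<dots> = (\<Sum>k'<4. \<Sum>l'<4. ?S k' l' / 4 * (16 * of_bool (k = k' \<and> l = l')))"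
    unfolding sum_distrib_left[symmetric] by (intro sum.cong refl) (simp add: square)
  also have "\<dots> = of_real (4 * spectral_mat \<mu> $$ (k,l))"
    using assms(2,3)[THEN less_4_disj] unfolding sum_lessThan_4 by (elim disjE) simp_all
  finally show ?thesis .
qed

text \<open>Transposing the output exchanges \<open>r\<close> and \<open>c\<close>, and the
  transposed Fierz identity rewrites the test matrices.\<close>

lemma choi_coeff_transpose:
  assumes T: "lin_map 4 4 T" and "k < 4" "l < 4"
  shows "choi_coeff (\<lambda>X. transpose_mat (T X)) k l =
    (\<Sum>i<4. \<Sum>j<4. of_real (refl_coeff (3 - k) i * refl_coeff (3 - l) j) * choi_coeff T i j)"
proof -
  have carrier: "T (unit_matrix a b) \<in> carrier_mat 4 4" for a b
    using T unfolding lin_map_def by simp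
  let ?g = "\<lambda>k l a b r c. pauli2 k l $$ (r,a) * pauli2 k l $$ (b,c)"
  let ?w = "\<lambda>i j. complex_of_real (refl_coeff (3 - k) i * refl_coeff (3 - l) j)"
  have "choi_coeff (\<lambda>X. transpose_mat (T X)) k l = (\<Sum>a<4. \<Sum>b<4. \<Sum>r<4. \<Sum>c<4.
      T (unit_matrix a b) $$ (c,r) * ?g k l a b r c)"
    unfolding choi_coeff_def using carrier
    by (intro sum.cong refl) (auto simp: carrier_matD[OF carrier])
  also have "\<dots> = (\<Sum>a<4. \<Sum>b<4. \<Sum>c<4. \<Sum>r<4. T (unit_matrix a b) $$ (c,r) * ?g k l a b r c)"
    by (rule sum.cong[OF refl], rule sum.cong[OF refl], rule sum.swap)
  also have "\<dots> = (\<Sum>a<4. \<Sum>b<4. \<Sum>r<4. \<Sum>c<4. \<Sum>i<4. \<Sum>j<4.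
      ?w i j * (T (unit_matrix a b) $$ (r,c) * ?g i j a b r c))"
    by (intro sum.cong refl, subst pauli2_fierz_transpose[OF assms(2,3)])
      (simp_all add: sum_distrib_left mult_ac)
  also have "\<dots> = (\<Sum>a<4. \<Sum>b<4. \<Sum>i<4. \<Sum>j<4. \<Sum>r<4. \<Sum>c<4.
      ?w i j * (T (unit_matrix a b) $$ (r,c) * ?g i j a b r c))"
    by (rule sum.cong[OF refl], rule sum.cong[OF refl], rule sum_swap_pairs)
  also have "\<dots> = (\<Sum>i<4. \<Sum>j<4. \<Sum>a<4. \<Sum>b<4. \<Sum>r<4. \<Sum>c<4.
      ?w i j * (T (unit_matrix a b) $$ (r,c) * ?g i j a b r c))"
    by (rule sum_swap_pairs)
  finally show ?thesis unfolding choi_coeff_def sum_distrib_left .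
qed

lemma refl_conj_sum_reverse:
  "(\<Sum>k<4. \<Sum>l<4. Q (3 - k, 3 - l) * (refl_coeff (3 - k) i * refl_coeff (3 - l) j)) = refl_conj Q i j"
proof -
  have "(\<Sum>k<4. \<Sum>l<4. Q (3 - k, 3 - l) * (refl_coeff (3 - k) i * refl_coeff (3 - l) j)) =
      (\<Sum>k<4. \<Sum>l<4. Q (k, l) * (refl_coeff k i * refl_coeff l j))"
    unfolding sum_lessThan_4 by simp
  also have "\<dots> = refl_conj Q i j"
    unfolding refl_conj_def by (intro sum.cong refl) (auto simp: refl_coeff_def)
  finally show ?thesis .
qed

text \<open>Choi coefficients see only the Pauli diagonal part of a map, so the two summands of a
  decomposition may be arbitrary. Conversely, nonnegative \<open>P\<close> and \<open>Q\<close>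
  serve as Kraus weights.\<close>

lemma decomposable_pauli_diag_map_iff:
  assumes \<mu>: "\<mu> \<in> carrier_mat 4 4"
  shows "decomposable 4 (pauli_diag_map \<mu>) \<longleftrightarrow>
    (\<exists>P Q. \<forall>i<4. \<forall>j<4. 0 \<le> P (i,j) \<and> 0 \<le> Q (i,j) \<and> spectral_mat \<mu> $$ (i,j) = P (i,j) + refl_conj Q i j)"
proof
  assume "decomposable 4 (pauli_diag_map \<mu>)"
  then obtain T T' where T: "completely_positive 4 4 T" "completely_positive 4 4 T'"
    and sum: "\<And>X. X \<in> carrier_mat 4 4 \<Longrightarrow> pauli_diag_map \<mu> X = T X + transpose_mat (T' X)"
    unfolding decomposable_def by blast
  have lin: "lin_map 4 4 T" "lin_map 4 4 T'"
    using T unfolding completely_positive_def by blast+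
  then have carrier: "T X \<in> carrier_mat 4 4" "T' X \<in> carrier_mat 4 4" if "X \<in> carrier_mat 4 4" for X
    using that unfolding lin_map_def by blast+
  have choi_sum: "choi_coeff (pauli_diag_map \<mu>) k l =
      choi_coeff T k l + choi_coeff (\<lambda>X. transpose_mat (T' X)) k l" for k l
    unfolding choi_coeff_def sum.distrib[symmetric]
    by (intro sum.cong refl) (simp add: sum carrier_matD[OF carrier(2)] algebra_simps)
  define P where "P = (\<lambda>(k,l). Re (choi_coeff T k l) / 4)"
  \<comment> \<open>The reversal undoes the \<open>3 - k\<close> and \<open>3 - l\<close> that
    transposition introduces, so that plain \<open>refl_conj Q\<close> results.\<close>
  define Q where "Q = (\<lambda>(k,l). Re (choi_coeff T' (3 - k) (3 - l)) / 4)"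
  have "0 \<le> P (k,l) \<and> 0 \<le> Q (k,l) \<and> spectral_mat \<mu> $$ (k,l) = P (k,l) + refl_conj Q k l"
    if "k < 4" "l < 4" for k l
  proof (intro conjI)
    show "0 \<le> P (k,l)" "0 \<le> Q (k,l)"
      using choi_coeff_nonneg[OF T(1), of k l] choi_coeff_nonneg[OF T(2), of "3 - k" "3 - l"]
      by (simp_all add: P_def Q_def less_eq_complex_def)
    have "4 * spectral_mat \<mu> $$ (k,l) = Re (choi_coeff (pauli_diag_map \<mu>) k l)"
      by (simp add: choi_coeff_pauli_diag_map[OF \<mu> that])
    also have "\<dots> = 4 * P (k,l) + refl_conj (\<lambda>(i,j). Re (choi_coeff T' i j)) (3 - k) (3 - l)"
      unfolding choi_sum choi_coeff_transpose[OF lin(2) that] by (simp add: P_def refl_conj_def)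
    also have "refl_conj (\<lambda>(i,j). Re (choi_coeff T' i j)) (3 - k) (3 - l) = 4 * refl_conj Q k l"
      unfolding refl_conj_reverse[OF that] by (simp add: Q_def refl_conj_def sum_distrib_left)
    finally show "spectral_mat \<mu> $$ (k,l) = P (k,l) + refl_conj Q k l" by simp
  qed
  then show "\<exists>P Q. \<forall>i<4. \<forall>j<4. 0 \<le> P (i,j) \<and> 0 \<le> Q (i,j) \<and>
    spectral_mat \<mu> $$ (i,j) = P (i,j) + refl_conj Q i j" by blast
next
  assume "\<exists>P Q. \<forall>i<4. \<forall>j<4. 0 \<le> P (i,j) \<and> 0 \<le> Q (i,j) \<and>
    spectral_mat \<mu> $$ (i,j) = P (i,j) + refl_conj Q i j"
  then obtain P Q where PQ: "\<And>i j. i < 4 \<Longrightarrow> j < 4 \<Longrightarrow> 0 \<le> P (i,j) \<and> 0 \<le> Q (i,j) \<and>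
    spectral_mat \<mu> $$ (i,j) = P (i,j) + refl_conj Q i j"
    by blast
  let ?I = "{..<4::nat} \<times> {..<4::nat}"
  define T where "T = kraus_map 4 ?I (\<lambda>(k,l). P (k,l) / 4) (\<lambda>(k,l). pauli2 k l)"
  \<comment> \<open>Transposing the Kraus term at \<open>(k,l)\<close> yields the reflection row
    \<open>(3 - k, 3 - l)\<close>, and the weight is read at that position.\<close>
  define T' where "T' = kraus_map 4 ?I (\<lambda>(k,l). Q (3 - k, 3 - l) / 4) (\<lambda>(k,l). pauli2 k l)"
  have "completely_positive 4 4 T" "completely_positive 4 4 T'"
    unfolding T_def T'_def by (rule completely_positive_kraus_map; use PQ in auto)+
  moreover have "pauli_diag_map \<mu> X = T X + transpose_mat (T' X)" if X: "X \<in> carrier_mat 4 4" for X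
  proof (rule eq_matI)
    fix r c
    assume "r < dim_row (T X + transpose_mat (T' X))" "c < dim_col (T X + transpose_mat (T' X))"
    then have rc: "r < 4" "c < 4" by (simp_all add: T'_def kraus_map_def)
    define g where "g k l a b = pauli2 k l $$ (r,a) * pauli2 k l $$ (b,c)" for k l a b
    define G where "G k l = (\<Sum>a<4. \<Sum>b<4. X $$ (a,b) * g k l a b)" for k l
    have T: "T X $$ (r,c) = (\<Sum>k<4. \<Sum>l<4. of_real (P (k,l) / 4) * G k l)"
      using rc by (simp add: T_def kraus_map_def sum.cartesian_product' G_def g_def pauli2_hermitian mult_ac)
    have "T' X $$ (c,r) = (\<Sum>k<4. \<Sum>l<4. of_real (Q (3 - k, 3 - l) / 4) *
        (\<Sum>a<4. \<Sum>b<4. X $$ (a,b) * (pauli2 k l $$ (c,a) * pauli2 k l $$ (b,r))))"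
      using rc by (simp add: T'_def kraus_map_def sum.cartesian_product' pauli2_hermitian mult_ac)
    also have "\<dots> = (\<Sum>k<4. \<Sum>l<4. of_real (Q (3 - k, 3 - l) / 4) *
        (\<Sum>a<4. \<Sum>b<4. \<Sum>i<4. \<Sum>j<4. of_real (refl_coeff (3 - k) i * refl_coeff (3 - l) j) *
          (X $$ (a,b) * g i j a b)))"
      by (intro sum.cong refl arg_cong2[where f = "(*)"], subst pauli2_fierz_transpose)
        (simp_all add: rc g_def sum_distrib_left mult_ac)
    also have "\<dots> = (\<Sum>k<4. \<Sum>l<4. of_real (Q (3 - k, 3 - l) / 4) *
        (\<Sum>i<4. \<Sum>j<4. \<Sum>a<4. \<Sum>b<4. of_real (refl_coeff (3 - k) i * refl_coeff (3 - l) j) *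
          (X $$ (a,b) * g i j a b)))"
      by (rule sum.cong[OF refl], rule sum.cong[OF refl], rule arg_cong[where f = "(*) _"], rule sum_swap_pairs)
    also have "\<dots> = (\<Sum>k<4. \<Sum>l<4. \<Sum>i<4. \<Sum>j<4.
        of_real (Q (3 - k, 3 - l) * (refl_coeff (3 - k) i * refl_coeff (3 - l) j)) * (G i j / 4))"
      by (simp add: G_def sum_distrib_left sum_divide_distrib mult_ac)
    also have "\<dots> = (\<Sum>i<4. \<Sum>j<4. of_real (refl_conj Q i j) * (G i j / 4))"
      by (subst sum_swap_pairs) (simp only: sum_distrib_right[symmetric] of_real_sum[symmetric] refl_conj_sum_reverse)
    finally have T': "T' X $$ (c,r) = (\<Sum>i<4. \<Sum>j<4. of_real (refl_conj Q i j) * (G i j / 4))" .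
    have "pauli_diag_map \<mu> X $$ (r,c) = (\<Sum>k<4. \<Sum>l<4. of_real ((P (k,l) + refl_conj Q k l) / 4) * G k l)"
      unfolding pauli_diag_map_index[OF \<mu> X rc] G_def g_def
      by (intro sum.cong refl) (simp add: PQ mult_ac)
    also have "\<dots> = T X $$ (r,c) + T' X $$ (c,r)"
      unfolding T T' sum.distrib[symmetric] by (intro sum.cong refl) (simp add: field_simps)
    finally show "pauli_diag_map \<mu> X $$ (r,c) = (T X + transpose_mat (T' X)) $$ (r,c)"
      using rc by (simp add: T'_def kraus_map_def)
  qed (simp_all add: pauli_diag_map_def T'_def kraus_map_def)
  ultimately show "decomposable 4 (pauli_diag_map \<mu>)"
    unfolding decomposable_def by blast
qed

section \<open>Positivity\<close>

definition pauli_amp :: "(nat \<Rightarrow> complex) \<Rightarrow> (nat \<Rightarrow> complex) \<Rightarrow> nat \<Rightarrow> nat \<Rightarrow> complex" where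
  "pauli_amp u v k l = (\<Sum>r<4. \<Sum>a<4. cnj (u r) * pauli2 k l $$ (r,a) * v a)"

text \<open>The image of the rank-one matrix of \<open>v\<close> is tested at \<open>u\<close>. In
  Kraus form every term becomes a squared modulus, so amplitudes supported on a given pattern yield
  the inequality for that pattern.\<close>

lemma positive_pauli_diag_map_amp:
  assumes \<mu>: "\<mu> \<in> carrier_mat 4 4" and pos: "positive_map 4 4 (pauli_diag_map \<mu>)"
  shows "0 \<le> (\<Sum>k<4. \<Sum>l<4. spectral_mat \<mu> $$ (k,l) * (cmod (pauli_amp u v k l))\<^sup>2)"
proof -
  define X where "X = mat 4 4 (\<lambda>(a,b). v a * cnj (v b))"
  have X: "X \<in> carrier_mat 4 4" by (simp add: X_def)
  have X_index: "X $$ (a,b) = v a * cnj (v b)" if "a < 4" "b < 4" for a b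
    using that by (simp add: X_def)
  have "0 \<le> quad_form 4 X w" for w
  proof -
    have "quad_form 4 X w = (\<Sum>i<4. cnj (w i) * v i) * cnj (\<Sum>i<4. cnj (w i) * v i)"
      unfolding quad_form_def cnj_sum sum_product by (intro sum.cong refl) (simp add: X_index)
    moreover have "0 \<le> z * cnj z" for z :: complex
      by (simp add: less_eq_complex_def mult.commute)
    ultimately show ?thesis by metis
  qed
  then have "psd 4 X" using X by (simp add: psd_iff_quad_form)
  then have "psd 4 (pauli_diag_map \<mu> X)" using pos unfolding positive_map_def by blast
  then have "0 \<le> quad_form 4 (pauli_diag_map \<mu> X) u" by (simp add: psd_iff_quad_form)
  also have "quad_form 4 (pauli_diag_map \<mu> X) u = (\<Sum>r<4. \<Sum>c<4. \<Sum>k<4. \<Sum>l<4.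
      of_real (spectral_mat \<mu> $$ (k,l) / 4) * (\<Sum>a<4. \<Sum>b<4.
        (cnj (u r) * pauli2 k l $$ (r,a) * v a) * cnj (cnj (u c) * pauli2 k l $$ (c,b) * v b)))"
    unfolding quad_form_def
    by (intro sum.cong refl)
      (simp add: pauli_diag_map_index[OF \<mu> X] X_index pauli2_hermitian sum_distrib_left sum_distrib_right mult_ac)
  also have "\<dots> = (\<Sum>k<4. \<Sum>l<4. \<Sum>r<4. \<Sum>c<4.
      of_real (spectral_mat \<mu> $$ (k,l) / 4) * (\<Sum>a<4. \<Sum>b<4.
        (cnj (u r) * pauli2 k l $$ (r,a) * v a) * cnj (cnj (u c) * pauli2 k l $$ (c,b) * v b)))"
    by (rule sum_swap_pairs)
  also have "\<dots> = (\<Sum>k<4. \<Sum>l<4. of_real (spectral_mat \<mu> $$ (k,l) / 4) *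
      (pauli_amp u v k l * cnj (pauli_amp u v k l)))"
    unfolding pauli_amp_def cnj_sum sum_product sum_distrib_left[symmetric] ..
  also have "\<dots> = of_real ((\<Sum>k<4. \<Sum>l<4. spectral_mat \<mu> $$ (k,l) * (cmod (pauli_amp u v k l))\<^sup>2) / 4)"
    by (simp add: sum_divide_distrib flip: complex_norm_square)
  finally show ?thesis by (simp add: less_eq_complex_def)
qed

lemma pauli_amp_product:
  "pauli_amp (\<lambda>r. s (r div 2) * t (r mod 2)) (\<lambda>a. x (a div 2) * y (a mod 2)) k l =
    (\<Sum>r<2. \<Sum>a<2. cnj (s r) * pauli k $$ (r,a) * x a) * (\<Sum>r<2. \<Sum>a<2. cnj (t r) * pauli l $$ (r,a) * y a)"
  unfolding pauli_amp_def sum_lessThan_4 sum_lessThan_2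
  by (simp add: pauli2_index algebra_simps)

lemma pauli_amp_pair:
  assumes "i < 4" "j < 4" "i \<noteq> j"
  shows "\<exists>s x. \<forall>k<4. (cmod (\<Sum>r<2. \<Sum>a<2. cnj (s r) * pauli k $$ (r,a) * x a))\<^sup>2 = of_bool (k \<in> {i,j})"
proof -
  define amp where "amp s x k = (\<Sum>r<2. \<Sum>a<2. cnj (s r) * pauli k $$ (r,a) * x a)" for s x k
  define supported where "supported i j \<longleftrightarrow> (\<exists>s x. \<forall>k<4. (cmod (amp s x k))\<^sup>2 = of_bool (k \<in> {i,j}))"
    for i j :: nat
  have supportedI: "supported i j" if "\<forall>k\<in>{..<4}. (cmod (amp s x k))\<^sup>2 = of_bool (k \<in> {i,j})" for i j s x
    using that unfolding supported_def by blast
  have commute: "supported i j \<longleftrightarrow> supported j i" for i j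
    unfolding supported_def by (simp add: insert_commute)
  \<comment> \<open>Eigenvectors of \<open>pauli 2\<close>, and below of \<open>pauli 1\<close> and
    \<open>pauli 3\<close>. Pauli matrices commuting with the chosen one preserve its eigenlines,
    the others exchange them. Equal vectors therefore select the identity and that matrix, different
    ones the remaining pair.\<close>
  define z0 z1 :: "nat \<Rightarrow> complex" where "z0 r = of_bool (r = 0)" and "z1 r = of_bool (r = 1)" for r
  define x0 x1 :: "nat \<Rightarrow> complex" where "x0 r = of_real (sqrt (1/2))"
    and "x1 r = of_real (sqrt (1/2)) * (if r = 0 then 1 else -1)" for r
  define y0 y1 :: "nat \<Rightarrow> complex" where "y0 r = of_real (sqrt (1/2)) * (if r = 0 then 1 else \<i>)"
    and "y1 r = of_real (sqrt (1/2)) * (if r = 0 then 1 else - \<i>)" for r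
  note defs = z0_def z1_def x0_def x1_def y0_def y1_def
  have half: "complex_of_real (sqrt (1/2)) * (complex_of_real (sqrt (1/2)) * z) = z / 2"
     "complex_of_real (sqrt (1/2)) * complex_of_real (sqrt (1/2)) = 1 / 2" for z
    by (simp_all flip: of_real_mult add: mult.assoc[symmetric])
  have "\<forall>k\<in>{..<4}. (cmod (amp z0 z0 k))\<^sup>2 = of_bool (k \<in> {0,2})"
       "\<forall>k\<in>{..<4}. (cmod (amp z1 z0 k))\<^sup>2 = of_bool (k \<in> {1,3})"
       "\<forall>k\<in>{..<4}. (cmod (amp x0 x0 k))\<^sup>2 = of_bool (k \<in> {0,1})"
       "\<forall>k\<in>{..<4}. (cmod (amp x1 x0 k))\<^sup>2 = of_bool (k \<in> {2,3})"
       "\<forall>k\<in>{..<4}. (cmod (amp y0 y0 k))\<^sup>2 = of_bool (k \<in> {0,3})"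
       "\<forall>k\<in>{..<4}. (cmod (amp y1 y0 k))\<^sup>2 = of_bool (k \<in> {1,2})"
    unfolding amp_def defs sum_lessThan_2 lessThan_4
    by (simp_all add: pauli_index algebra_simps half)
  note this[THEN supportedI]
  then have "supported i j"
    using less_4_disj[OF assms(1)] less_4_disj[OF assms(2)] assms(3) commute
    by (elim disjE; hypsubst; simp; fail)
  then show ?thesis unfolding supported_def amp_def .
qed

text \<open>Clifford-type matrices: up to phases, \<open>X \<mapsto> L X R\<close> permutes the Pauli matrices by \<open>p\<close>.\<close>
definition pauli_permuting :: "(nat \<Rightarrow> nat) \<Rightarrow> bool" where
  "pauli_permuting p \<longleftrightarrow> (\<exists>L R c \<omega>. 0 < c \<and> (\<forall>k<4. cmod (\<omega> k) = c \<and>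
    (\<forall>i<2. \<forall>j<2. (\<Sum>a<2. \<Sum>b<2. L i a * pauli k $$ (a,b) * R b j) = \<omega> k * pauli (p k) $$ (i,j))))"

lemma pauli_permutingI:
  assumes "0 < c" "\<And>k. k < 4 \<Longrightarrow> cmod (\<omega> k) = c"
    "\<And>k i j. k < 4 \<Longrightarrow> i < 2 \<Longrightarrow> j < 2 \<Longrightarrow>
      (\<Sum>a<2. \<Sum>b<2. L i a * pauli k $$ (a,b) * R b j) = \<omega> k * pauli (p k) $$ (i,j)"
  shows "pauli_permuting p"
  unfolding pauli_permuting_def
  by (rule exI[of _ L], rule exI[of _ R], rule exI[of _ c], rule exI[of _ \<omega>]) (use assms in blast)

lemma pauli_permuting_id: "pauli_permuting id"
proof (rule pauli_permutingI[of 1 "\<lambda>_. 1" "\<lambda>i a. of_bool (i = a)" "\<lambda>i a. of_bool (i = a)"])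
  fix k i j :: nat assume "i < 2" "j < 2"
  then show "(\<Sum>a<2. \<Sum>b<2. of_bool (i = a) * pauli k $$ (a,b) * of_bool (b = j)) = 1 * pauli (id k) $$ (i,j)"
    using less_2_disj[of i] less_2_disj[of j] unfolding sum_lessThan_2 by auto
qed simp_all

lemma pauli_permuting_comp:
  assumes "pauli_permuting p" "pauli_permuting q" "\<And>k. k < 4 \<Longrightarrow> p k < 4"
  shows "pauli_permuting (q \<circ> p)"
proof -
  obtain L R c \<omega> where p: "0 < c" "\<And>k. k < 4 \<Longrightarrow> cmod (\<omega> k) = c"
    "\<And>k i j. k < 4 \<Longrightarrow> i < 2 \<Longrightarrow> j < 2 \<Longrightarrow>
      (\<Sum>a<2. \<Sum>b<2. L i a * pauli k $$ (a,b) * R b j) = \<omega> k * pauli (p k) $$ (i,j)"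
    using assms(1) unfolding pauli_permuting_def by blast
  obtain L' R' c' \<omega>' where q: "0 < c'" "\<And>k. k < 4 \<Longrightarrow> cmod (\<omega>' k) = c'"
    "\<And>k i j. k < 4 \<Longrightarrow> i < 2 \<Longrightarrow> j < 2 \<Longrightarrow>
      (\<Sum>a<2. \<Sum>b<2. L' i a * pauli k $$ (a,b) * R' b j) = \<omega>' k * pauli (q k) $$ (i,j)"
    using assms(2) unfolding pauli_permuting_def by blast
  show ?thesis
  proof (rule pauli_permutingI[of "c * c'" "\<lambda>k. \<omega> k * \<omega>' (p k)"
        "\<lambda>i a. \<Sum>d<2. L' i d * L d a" "\<lambda>b j. \<Sum>d<2. R b d * R' d j"])
    fix k i j :: nat assume k: "k < 4" and ij: "i < 2" "j < 2"
    have "(\<Sum>a<2. \<Sum>b<2. (\<Sum>d<2. L' i d * L d a) * pauli k $$ (a,b) * (\<Sum>d<2. R b d * R' d j)) =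
        (\<Sum>e<2. \<Sum>d<2. L' i e * (\<Sum>a<2. \<Sum>b<2. L e a * pauli k $$ (a,b) * R b d) * R' d j)"
      unfolding sum_lessThan_2 by (simp add: algebra_simps)
    also have "\<dots> = (\<Sum>e<2. \<Sum>d<2. L' i e * (\<omega> k * pauli (p k) $$ (e,d)) * R' d j)"
      by (intro sum.cong refl) (simp add: p(3)[OF k])
    also have "\<dots> = \<omega> k * (\<Sum>e<2. \<Sum>d<2. L' i e * pauli (p k) $$ (e,d) * R' d j)"
      by (simp add: sum_distrib_left mult_ac)
    also have "\<dots> = \<omega> k * \<omega>' (p k) * pauli ((q \<circ> p) k) $$ (i,j)"
      using k ij assms(3) by (simp add: q(3))
    finally show "(\<Sum>a<2. \<Sum>b<2. (\<Sum>d<2. L' i d * L d a) * pauli k $$ (a,b) * (\<Sum>d<2. R b d * R' d j)) =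
      \<omega> k * \<omega>' (p k) * pauli ((q \<circ> p) k) $$ (i,j)" .
  qed (use p q assms(3) in \<open>simp_all add: norm_mult\<close>)
qed

text \<open>Conjugation by \<open>\<sigma>\<^sub>a + \<sigma>\<^sub>b\<close> swaps two non-identity Pauli matrices;
  two-sided multiplication by \<open>1 + \<i> \<sigma>\<^sub>b\<close> swaps \<open>1\<close> and \<open>\<sigma>\<^sub>b\<close>.\<close>
lemma pauli_swap:
  fixes a b k i j :: nat
  defines "\<zeta> \<equiv> (if a = 0 then \<i> else 1)"
  defines "\<omega> \<equiv> (if a = 0 then (if k = 0 \<or> k = b then 2 * \<i> else 2)
    else (if k = 0 \<or> k = a \<or> k = b then 2 else - 2))"
  defines "U \<equiv> (\<lambda>i j. pauli a $$ (i,j) + \<zeta> * pauli b $$ (i,j))"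
  assumes "a < b" "b < 4" "k < 4" "i < 2" "j < 2"
  shows "(\<Sum>c<2. \<Sum>d<2. U i c * pauli k $$ (c,d) * U d j) = \<omega> * pauli (Transposition.transpose a b k) $$ (i,j)"
proof -
  have "a = 0 \<and> b = 1 \<or> a = 0 \<and> b = 2 \<or> a = 0 \<and> b = 3 \<or> a = 1 \<and> b = 2 \<or> a = 1 \<and> b = 3 \<or> a = 2 \<and> b = 3"
    using assms(4,5) by linarith
  then show ?thesis
    using less_4_disj[OF \<open>k < 4\<close>] less_2_disj[OF \<open>i < 2\<close>] less_2_disj[OF \<open>j < 2\<close>]
    unfolding sum_lessThan_2 U_def \<omega>_def \<zeta>_def
    by (elim disjE conjE; hypsubst) (simp_all add: pauli_index transpose_eq_iff algebra_simps)
qed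

lemma pauli_permuting_transpose:
  assumes "a < 4" "b < 4"
  shows "pauli_permuting (Transposition.transpose a b)"
proof -
  have less: "pauli_permuting (Transposition.transpose a b)" if "a < b" "b < 4" for a b
    \<comment> \<open>All phases in \<open>pauli_swap\<close> are among \<open>2\<close>,
      \<open>-2\<close> and \<open>2 * \<i>\<close>, hence the common modulus 2.\<close>
    by (rule pauli_permutingI[OF _ _ pauli_swap[OF that], of 2]) (auto simp: norm_mult)
  show ?thesis
    using less[of a b] less[of b a] assms pauli_permuting_id
    by (cases a b rule: linorder_cases) (auto simp: transpose_commute)
qed

text \<open>Transpositions generate the symmetric group, and the property is closed under
  composition.\<close>

lemma pauli_permuting_permutes:
  assumes "p permutes {..<4}"
  shows "pauli_permuting p"
  using assms finite_lessThan
proof (induction rule: permutes_induct)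
  case id
  show ?case by (rule pauli_permuting_id)
next
  case (swap a b p)
  show ?case
  proof (rule pauli_permuting_comp)
    show "p k < 4" if "k < 4" for k
      using permutes_in_image[OF \<open>p permutes {..<4}\<close>, of k] that by simp
  qed (use swap pauli_permuting_transpose in auto)
qed

section \<open>The two families implied by positivity\<close>

lemma positive_pauli_diag_map_diagonal:
  assumes \<mu>: "\<mu> \<in> carrier_mat 4 4" and pos: "positive_map 4 4 (pauli_diag_map \<mu>)"
    and p: "p permutes {..<4}"
  shows "0 \<le> (\<Sum>k<4. spectral_mat \<mu> $$ (k, p k))"
proof -
  obtain L R c \<omega> where LR: "0 < c" "\<And>k. k < 4 \<Longrightarrow> cmod (\<omega> k) = c"
    "\<And>k i j. k < 4 \<Longrightarrow> i < 2 \<Longrightarrow> j < 2 \<Longrightarrow>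
      (\<Sum>a<2. \<Sum>b<2. L i a * pauli k $$ (a,b) * R b j) = \<omega> k * pauli (p k) $$ (i,j)"
    using pauli_permuting_permutes[OF p] unfolding pauli_permuting_def by blast
  \<comment> \<open>Vectorisations of \<open>L\<close> and \<open>R\<close>, with \<open>L\<close>
    transposed and conjugated, so that the amplitude at \<open>(k,l)\<close> becomes the bilinear
    pairing of \<open>L * pauli k * R\<close> with \<open>pauli l\<close>.\<close>
  define u v where "u r = cnj (L (r mod 2) (r div 2))" and "v a = R (a div 2) (a mod 2)" for r a :: nat
  have amp: "(cmod (pauli_amp u v k l))\<^sup>2 = 4 * c\<^sup>2 * of_bool (l = p k)" if "k < 4" "l < 4" for k l
  proof -
    have "p k < 4" using permutes_in_image[OF p, of k] that by simp
    have "pauli_amp u v k l =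
        (\<Sum>i<2. \<Sum>j<2. (\<Sum>a<2. \<Sum>b<2. L i a * pauli k $$ (a,b) * R b j) * pauli l $$ (i,j))"
      unfolding pauli_amp_def u_def v_def sum_lessThan_4 sum_lessThan_2
      by (simp add: pauli2_index algebra_simps)
    also have "\<dots> = (\<Sum>i<2. \<Sum>j<2. \<omega> k * pauli (p k) $$ (i,j) * pauli l $$ (i,j))"
      by (intro sum.cong refl) (simp add: LR(3)[OF \<open>k < 4\<close>])
    also have "\<dots> = \<omega> k * (\<Sum>i<2. \<Sum>j<2. pauli (p k) $$ (i,j) * pauli l $$ (i,j))"
      by (simp add: sum_distrib_left mult_ac)
    \<comment> \<open>The pairing may be negative, so orthogonality is available only for squares.
      The modulus of the squared amplitude is the squared modulus that is sought.\<close>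
    finally have "(pauli_amp u v k l)\<^sup>2 = (\<omega> k)\<^sup>2 * (4 * of_bool (p k = l))"
      by (simp only: power_mult_distrib pauli_orthogonal[OF \<open>p k < 4\<close> \<open>l < 4\<close>])
    then have "cmod ((pauli_amp u v k l)\<^sup>2) = c\<^sup>2 * (4 * of_bool (p k = l))"
      by (simp add: norm_mult norm_power LR(2) that)
    then show ?thesis by (auto simp: norm_power)
  qed
  have "0 \<le> (\<Sum>k<4. \<Sum>l<4. spectral_mat \<mu> $$ (k,l) * (cmod (pauli_amp u v k l))\<^sup>2)"
    by (rule positive_pauli_diag_map_amp[OF \<mu> pos])
  also have "\<dots> = (\<Sum>k<4. \<Sum>l<4. 4 * c\<^sup>2 * (if l = p k then spectral_mat \<mu> $$ (k,l) else 0))"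
    by (intro sum.cong refl) (simp add: amp)
  also have "\<dots> = 4 * c\<^sup>2 * (\<Sum>k<4. spectral_mat \<mu> $$ (k, p k))"
    unfolding sum_distrib_left using permutes_in_image[OF p]
    by (intro sum.cong refl) (simp flip: sum_distrib_left)
  finally show ?thesis using LR(1) by (simp add: zero_le_mult_iff)
qed

text \<open>For product vectors the amplitude factorises, and each factor is supported on a
  prescribed pair of indices.\<close>

lemma positive_pauli_diag_map_block:
  assumes \<mu>: "\<mu> \<in> carrier_mat 4 4" and pos: "positive_map 4 4 (pauli_diag_map \<mu>)"
    and p: "p permutes {..<4}" and q: "q permutes {..<4}"
  shows "0 \<le> (\<Sum>i<2. \<Sum>j<2. spectral_mat \<mu> $$ (p i, q j))"
proof -
  have less: "p i < 4" "q i < 4" if "i < 4" for i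
    using permutes_in_image[OF p, of i] permutes_in_image[OF q, of i] that by auto
  have neq: "p 0 \<noteq> p 1" "q 0 \<noteq> q 1"
    by (simp_all add: inj_eq[OF permutes_inj[OF p]] inj_eq[OF permutes_inj[OF q]])
  obtain s x where sx: "\<And>k. k < 4 \<Longrightarrow>
      (cmod (\<Sum>r<2. \<Sum>a<2. cnj (s r) * pauli k $$ (r,a) * x a))\<^sup>2 = of_bool (k \<in> {p 0, p 1})"
    using pauli_amp_pair[of "p 0" "p 1"] less neq by auto
  obtain t y where ty: "\<And>k. k < 4 \<Longrightarrow>
      (cmod (\<Sum>r<2. \<Sum>a<2. cnj (t r) * pauli k $$ (r,a) * y a))\<^sup>2 = of_bool (k \<in> {q 0, q 1})"
    using pauli_amp_pair[of "q 0" "q 1"] less neq by auto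
  define u v where "u r = s (r div 2) * t (r mod 2)" and "v a = x (a div 2) * y (a mod 2)" for r a :: nat
  have amp: "(cmod (pauli_amp u v k l))\<^sup>2 = of_bool (k \<in> {p 0, p 1}) * of_bool (l \<in> {q 0, q 1})"
    if "k < 4" "l < 4" for k l
    unfolding u_def v_def pauli_amp_product norm_mult power_mult_distrib
    by (simp only: sx[OF that(1)] ty[OF that(2)])
  have inj: "p i \<in> {p 0, p 1} \<longleftrightarrow> i < 2" "q i \<in> {q 0, q 1} \<longleftrightarrow> i < 2" for i
    by (auto simp: inj_eq[OF permutes_inj[OF p]] inj_eq[OF permutes_inj[OF q]])
  have "0 \<le> (\<Sum>k<4. \<Sum>l<4. spectral_mat \<mu> $$ (k,l) * (cmod (pauli_amp u v k l))\<^sup>2)"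
    by (rule positive_pauli_diag_map_amp[OF \<mu> pos])
  also have "\<dots> = (\<Sum>k<4. \<Sum>l<4. spectral_mat \<mu> $$ (p k, q l) * (cmod (pauli_amp u v (p k) (q l)))\<^sup>2)"
    by (rule sum_permuted[OF p q, symmetric])
  also have "\<dots> = (\<Sum>k<4. \<Sum>l<4. spectral_mat \<mu> $$ (p k, q l) * (of_bool (k < 2) * of_bool (l < 2)))"
    by (intro sum.cong refl) (simp only: amp less inj lessThan_iff)
  also have "\<dots> = (\<Sum>i<2. \<Sum>j<2. spectral_mat \<mu> $$ (p i, q j))"
    unfolding sum_lessThan_4 sum_lessThan_2 by simp
  finally show ?thesis .
qed

theorem mainTheorem13:
  fixes \<mu> :: "real mat"
  assumes "\<mu> \<in> carrier_mat 4 4"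
  defines "S \<equiv> spectral_mat \<mu>"
  shows "(decomposable 4 (pauli_diag_map \<mu>) \<longleftrightarrow>
           (\<forall>p q. p permutes {..<4::nat} \<longrightarrow> q permutes {..<4::nat} \<longrightarrow>
              S $$ (p 0, q 0) + S $$ (p 0, q 1) + S $$ (p 1, q 0) + S $$ (p 1, q 1) \<ge> 0 \<and>
              S $$ (p 0, q 0) + S $$ (p 1, q 1) + S $$ (p 2, q 2) + S $$ (p 3, q 3) \<ge> 0 \<and>
              S $$ (p 0, q 0) + S $$ (p 1, q 1) + S $$ (p 2, q 2)
                + S $$ (p 3, q 0) + S $$ (p 3, q 1) + S $$ (p 3, q 2) \<ge> 0 \<and>
              S $$ (p 0, q 0) + S $$ (p 1, q 1) + S $$ (p 2, q 2)
                + S $$ (p 0, q 3) + S $$ (p 1, q 3) + S $$ (p 2, q 3) \<ge> 0))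
       \<and> (positive_map 4 4 (pauli_diag_map \<mu>) \<longrightarrow>
           (\<forall>p q. p permutes {..<4::nat} \<longrightarrow> q permutes {..<4::nat} \<longrightarrow>
              S $$ (p 0, q 0) + S $$ (p 0, q 1) + S $$ (p 1, q 0) + S $$ (p 1, q 1) \<ge> 0 \<and>
              S $$ (p 0, q 0) + S $$ (p 1, q 1) + S $$ (p 2, q 2) + S $$ (p 3, q 3) \<ge> 0))"
proof -
  let ?f = "\<lambda>z. S $$ z"
  have patterns: "decomposable 4 (pauli_diag_map \<mu>) \<longleftrightarrow> (\<forall>p q. p permutes {..<4::nat} \<longrightarrow> q permutes {..<4::nat} \<longrightarrow>
    (\<forall>(c,d)\<in>ray_patterns. 0 \<le> (\<Sum>i<4. \<Sum>j<4. of_bool (c i j) * ?f (p i, q j))))"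
    (is "_ \<longleftrightarrow> ?patterns")
  proof
    assume "decomposable 4 (pauli_diag_map \<mu>)"
    then obtain P Q where "\<And>i j. i < 4 \<Longrightarrow> j < 4 \<Longrightarrow>
        0 \<le> P (i,j) \<and> 0 \<le> Q (i,j) \<and> ?f (i,j) = P (i,j) + refl_conj Q i j"
      unfolding decomposable_pauli_diag_map_iff[OF assms(1)] S_def by blast
    from pattern_sum_nonneg[of P Q ?f, OF this] show ?patterns by blast
  next
    assume ?patterns
    then have "0 \<le> (\<Sum>i<4. \<Sum>j<4. of_bool (c i j) * ?f (p i, q j))"
      if "(c,d) \<in> ray_patterns" "p permutes {..<4}" "q permutes {..<4}" for c d p q
      using that by blast
    then have "\<exists>P Q. \<forall>i<4. \<forall>j<4. 0 \<le> P (i,j) \<and> 0 \<le> Q (i,j) \<and> ?f (i,j) = P (i,j) + refl_conj Q i j"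
      by (rule refl_decomposition)
    then show "decomposable 4 (pauli_diag_map \<mu>)"
      unfolding decomposable_pauli_diag_map_iff[OF assms(1)] S_def .
  qed
  have positive: "0 \<le> S $$ (p 0, q 0) + S $$ (p 0, q 1) + S $$ (p 1, q 0) + S $$ (p 1, q 1) \<and>
      0 \<le> S $$ (p 0, q 0) + S $$ (p 1, q 1) + S $$ (p 2, q 2) + S $$ (p 3, q 3)"
    if pos: "positive_map 4 4 (pauli_diag_map \<mu>)" and p: "p permutes {..<4::nat}" and q: "q permutes {..<4::nat}"
    for p q
  proof
    show "0 \<le> S $$ (p 0, q 0) + S $$ (p 0, q 1) + S $$ (p 1, q 0) + S $$ (p 1, q 1)"
      using positive_pauli_diag_map_block[OF assms(1) pos p q] by (simp add: sum_lessThan_2 S_def)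
    \<comment> \<open>A diagonal over rows \<open>p i\<close> and columns \<open>q i\<close> is the
      graph of \<open>q\<close> after the inverse of \<open>p\<close>, so one permutation
      suffices.\<close>
    let ?r = "q \<circ> inv_into UNIV p"
    have "?r permutes {..<4}"
      by (rule permutes_compose[OF permutes_inv[OF p] q])
    then have "0 \<le> (\<Sum>k<4. S $$ (k, ?r k))"
      unfolding S_def by (rule positive_pauli_diag_map_diagonal[OF assms(1) pos])
    also have "\<dots> = (\<Sum>i<4. S $$ (p i, q i))"
      using sum.permute[OF p, of "\<lambda>k. S $$ (k, ?r k)"] by (simp add: comp_def permutes_inverses[OF p])
    finally show "0 \<le> S $$ (p 0, q 0) + S $$ (p 1, q 1) + S $$ (p 2, q 2) + S $$ (p 3, q 3)"
      by (simp add: sum_lessThan_4)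
  qed
  show ?thesis
    unfolding patterns pattern_sums_iff using positive by blast
qed

end
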